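(* Let $k\ge 2$, let $0=r_0<r_1<\dots<r_k$ be integers, $d=\gcd(r_1,\dots,r_k)$, and let $n$ be a positive integer with $\gcd(n,d)=1$ and $n>N$, where $N$ is the integer associated with $M_n=\langle n,n+r_1,\dots,n+r_k\rangle$ defined in the context. If $M_n$ is a nearly Gorenstein numerical semigroup, then $M_{n+\lambda r_k}$ is nearly Gorenstein for every $\lambda\in\mathbb{N}$. Moreover, if $(f_0,\dots,f_k)$ is an NG-vector for $M_n$, then $(\varphi_n^\lambda(f_0),\dots,\varphi_n^\lambda(f_k))$ is an NG-vector for $M_{n+\lambda r_k}$ for all $\lambda\in\mathbb{N}$.
   Context: $\mathbb{N}$ includes $0$, and $\langle a_1,\dots,a_s\rangle=\{\sum\lambda_i a_i\mid\lambda_i\in\mathbb{N}\}$. A numerical semigroup is an additive submonoid $H\subseteq\mathbb{N}$ with finite complement; $\operatorname{F}(H)=\max(\mathbb{Z}\setminus H)$ and $\operatorname{PF}(H)=\{x\in\mathbb{Z}\setminus H\mid x+h\in H\ \forall\, 0\neq h\in H\}$. Nearly Gorenstein: let $K(H)=\{x\in\mathbb{N}\mid \operatorname{F}(H)-x\notin H\}$, $H-K(H)=\{x\in\mathbb{Z}\mid x+K(H)\subseteq H\}$, $\operatorname{tr}(H)=K(H)+(H-K(H))$. $H$ is nearly Gorenstein if $H\setminus\{0\}\subseteq\operatorname{tr}(H)$. If $H$ is minimally generated by $h_0<h_1<\dots<h_k$, a vector $(f_0,\dots,f_k)\in\operatorname{PF}(H)^{k+1}$ is an NG-vector (nearly Gorenstein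 vector) for $H$ if $h_i+f_i-f\in H$ for every $f\in\operatorname{PF}(H)$ and every $i=0,\dots,k$; it is known (Moscariello–Strazzanti) that $H$ is nearly Gorenstein if and only if it has an NG-vector. When $n>r_k$, $M_n$ is minimally generated by $n,n+r_1,\dots,n+r_k$ (taken in this order). Notation: $S=\langle r_1,\dots,r_k\rangle$; $\operatorname{F}(S)=\max\{s\in\mathbb{Z}\setminus S\mid s\equiv0\bmod d\}$ (possibly negative); $N_0=\max\{r_k^2,r_k^2+\operatorname{F}(S)r_k\}$; for $i\in S$, $\mathbf{m}(i)$ is the minimum of $\lambda_1+\dots+\lambda_k$ over all expressions $i=\lambda_1r_1+\dots+\lambda_kr_k$ with $\lambda_j\in\mathbb{N}$; $\operatorname{Ap}(S,dn)=\{s\in S\mid s-dn\notin S\}$. For $n>N_0$ with $\gcd(n,d)=1$: $P_n=\{i\in\operatorname{Ap}(S,dn)\mid f\equiv i\bmod n\text{ for some }f\in\operatorname{PF}(M_n)\}$, $P_n'=\{i\in P_n\mid i<dn-r_k\}$, $P_n''=\{i\in P_n\mid i\ge dn-r_k\}$. Each $f\in\operatorname{PF}(M_n)$ is congruent mod $n$ to a unique $i\in P_n$, and this gives a bijection $\operatorname{PF}(M_n)\to P_n$. The map $\psi_n:P_n\to P_{n+r_k}$, $\psi_n(i)=i$ if $i<dn-r_k$ and $\psi_n(i)=i+dr_k$ if $i\ge dn-r_k$, is a bijection, and $\varphi_n:\operatorname{PF}(M_n)\to\operatorname{PF}(M_{n+r_k})$ is the induced bijection: if $f\equiv i\bmod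 n$ with $i\in P_n$, then $\varphi_n(f)$ is the unique element of $\operatorname{PF}(M_{n+r_k})$ congruent to $\psi_n(i)$ mod $n+r_k$. Put $\varphi_n^\lambda=\varphi_{n+(\lambda-1)r_k}\circ\dots\circ\varphi_{n+r_k}\circ\varphi_n$ ($\varphi_n^0=\mathrm{id}$). Definition of $N$ (for $M_n$ with $n>N_0$): $N_1=\max\{0,\ r_k+\ell-i,\ (\mathbf{m}(\ell)-\mathbf{m}(i))r_k-\ell+i \mid i,\ell\in P_n'\}$, $N_2=\max\{0,\ (\mathbf{m}(\ell)-\mathbf{m}(i))r_k-\ell+i\mid i,\ell\in P_n''\}$, $N_3=\max\{0,\ (\mathbf{m}(\ell)r_k+3r_k)/d\mid \ell\in P_n'\}$, $N=\max\{N_0+r_k+\operatorname{F}(S)/d,\ N_1,N_2,N_3\}$. The hypothesis $n>N$ includes $n>N_0$. *)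

theory Defs
  imports Main "HOL-Number_Theory.Cong"
begin

text \<open>All semigroups are represented as sets of integers, since Frobenius numbers,
  pseudo-Frobenius numbers and shifts may be negative.\<close>

definition gen_monoid :: "nat set \<Rightarrow> (nat \<Rightarrow> int) \<Rightarrow> int set" where
  "gen_monoid I a = {(\<Sum>i\<in>I. int (c i) * a i) | c :: nat \<Rightarrow> nat. True}"

definition numerical_semigroup :: "int set \<Rightarrow> bool" where
  "numerical_semigroup H \<longleftrightarrow>
     H \<subseteq> {0..} \<and> 0 \<in> H \<and> (\<forall>x\<in>H. \<forall>y\<in>H. x + y \<in> H) \<and> finite ({0..} - H)"

definition frobenius :: "int set \<Rightarrow> int" where
  "frobenius H = (GREATEST x. x \<notin> H)"

definition PF :: "int set \<Rightarrow> int set" where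
  "PF H = {x. x \<notin> H \<and> (\<forall>h\<in>H. h \<noteq> 0 \<longrightarrow> x + h \<in> H)}"

definition canonical_ideal :: "int set \<Rightarrow> int set" where
  "canonical_ideal H = {x. 0 \<le> x \<and> frobenius H - x \<notin> H}"

definition ideal_diff :: "int set \<Rightarrow> int set \<Rightarrow> int set" where
  "ideal_diff H K = {x. \<forall>y\<in>K. x + y \<in> H}"

definition trace_ideal :: "int set \<Rightarrow> int set" where
  "trace_ideal H =
     {x + y | x y. x \<in> canonical_ideal H \<and> y \<in> ideal_diff H (canonical_ideal H)}"

definition nearly_gorenstein :: "int set \<Rightarrow> bool" where
  "nearly_gorenstein H \<longleftrightarrow> numerical_semigroup H \<and> H - {0} \<subseteq> trace_ideal H"

definition minimally_generated :: "int set \<Rightarrow> nat \<Rightarrow> (nat \<Rightarrow> int) \<Rightarrow> bool" where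
  "minimally_generated H k h \<longleftrightarrow>
     strict_mono_on {..k} h \<and> H = gen_monoid {..k} h \<and>
     (\<forall>J. J \<subset> {..k} \<longrightarrow> gen_monoid J h \<noteq> H)"

text \<open>The vector \<open>(f 0, \<dots>, f k)\<close> is an NG-vector for the numerical semigroup \<open>H\<close> with
  minimal generators \<open>h 0 < \<dots> < h k\<close>; values of \<open>f\<close> and \<open>h\<close> beyond index \<open>k\<close> are irrelevant.\<close>

definition NG_vector :: "int set \<Rightarrow> nat \<Rightarrow> (nat \<Rightarrow> int) \<Rightarrow> (nat \<Rightarrow> int) \<Rightarrow> bool" where
  "NG_vector H k h f \<longleftrightarrow>
     numerical_semigroup H \<and> minimally_generated H k h \<and> (\<forall>i\<le>k. f i \<in> PF H) \<and>
     (\<forall>i\<le>k. \<forall>g\<in>PF H. h i + f i - g \<in> H)"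

text \<open>In the remaining definitions \<open>k\<close> and \<open>r\<close> are the data \<open>0 = r 0 < r 1 < \<dots> < r k\<close>.\<close>

definition shifted_gens :: "(nat \<Rightarrow> int) \<Rightarrow> int \<Rightarrow> nat \<Rightarrow> int" where
  "shifted_gens r n i = n + r i"

definition M :: "nat \<Rightarrow> (nat \<Rightarrow> int) \<Rightarrow> int \<Rightarrow> int set" where
  "M k r n = gen_monoid {..k} (shifted_gens r n)"

definition S :: "nat \<Rightarrow> (nat \<Rightarrow> int) \<Rightarrow> int set" where
  "S k r = gen_monoid {1..k} r"

definition gcd_r :: "nat \<Rightarrow> (nat \<Rightarrow> int) \<Rightarrow> int" where
  "gcd_r k r = Gcd (r ` {1..k})"

text \<open>Unlike \<open>frobenius\<close>, only multiples of the gcd are considered here; the value is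
  negative if every nonnegative multiple of the gcd lies in \<open>S k r\<close>.\<close>

definition F_S :: "nat \<Rightarrow> (nat \<Rightarrow> int) \<Rightarrow> int" where
  "F_S k r = (GREATEST s. s \<notin> S k r \<and> [s = 0] (mod gcd_r k r))"

definition N0 :: "nat \<Rightarrow> (nat \<Rightarrow> int) \<Rightarrow> int" where
  "N0 k r = max ((r k)\<^sup>2) ((r k)\<^sup>2 + F_S k r * r k)"

definition min_len :: "nat \<Rightarrow> (nat \<Rightarrow> int) \<Rightarrow> int \<Rightarrow> nat" where
  "min_len k r i =
     (LEAST m. \<exists>c :: nat \<Rightarrow> nat. i = (\<Sum>j\<in>{1..k}. int (c j) * r j) \<and> m = (\<Sum>j\<in>{1..k}. c j))"

definition Ap_S :: "nat \<Rightarrow> (nat \<Rightarrow> int) \<Rightarrow> int \<Rightarrow> int set" where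
  "Ap_S k r n = {s \<in> S k r. s - gcd_r k r * n \<notin> S k r}"

definition P :: "nat \<Rightarrow> (nat \<Rightarrow> int) \<Rightarrow> int \<Rightarrow> int set" where
  "P k r n = {i \<in> Ap_S k r n. \<exists>f\<in>PF (M k r n). [f = i] (mod n)}"

definition P_low :: "nat \<Rightarrow> (nat \<Rightarrow> int) \<Rightarrow> int \<Rightarrow> int set" where
  "P_low k r n = {i \<in> P k r n. i < gcd_r k r * n - r k}"

definition P_high :: "nat \<Rightarrow> (nat \<Rightarrow> int) \<Rightarrow> int \<Rightarrow> int set" where
  "P_high k r n = {i \<in> P k r n. i \<ge> gcd_r k r * n - r k}"

definition psi :: "nat \<Rightarrow> (nat \<Rightarrow> int) \<Rightarrow> int \<Rightarrow> int \<Rightarrow> int" where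
  "psi k r n i = (if i < gcd_r k r * n - r k then i else i + gcd_r k r * r k)"

definition P_index :: "nat \<Rightarrow> (nat \<Rightarrow> int) \<Rightarrow> int \<Rightarrow> int \<Rightarrow> int" where
  "P_index k r n f = (THE i. i \<in> P k r n \<and> [f = i] (mod n))"

definition phi :: "nat \<Rightarrow> (nat \<Rightarrow> int) \<Rightarrow> int \<Rightarrow> int \<Rightarrow> int" where
  "phi k r n f =
     (THE g. g \<in> PF (M k r (n + r k)) \<and> [g = psi k r n (P_index k r n f)] (mod (n + r k)))"

fun phi_iter :: "nat \<Rightarrow> (nat \<Rightarrow> int) \<Rightarrow> int \<Rightarrow> nat \<Rightarrow> int \<Rightarrow> int" where
  "phi_iter k r n 0 f = f"
| "phi_iter k r n (Suc l) f = phi k r (n + int l * r k) (phi_iter k r n l f)"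

definition N1 :: "nat \<Rightarrow> (nat \<Rightarrow> int) \<Rightarrow> int \<Rightarrow> int" where
  "N1 k r n = Max ({0}
     \<union> {r k + l - i | i l. i \<in> P_low k r n \<and> l \<in> P_low k r n}
     \<union> {(int (min_len k r l) - int (min_len k r i)) * r k - l + i | i l.
          i \<in> P_low k r n \<and> l \<in> P_low k r n})"

definition N2 :: "nat \<Rightarrow> (nat \<Rightarrow> int) \<Rightarrow> int \<Rightarrow> int" where
  "N2 k r n = Max ({0}
     \<union> {(int (min_len k r l) - int (min_len k r i)) * r k - l + i | i l.
          i \<in> P_high k r n \<and> l \<in> P_high k r n})"

text \<open>The integer divisions in the next two definitions are exact, because the gcd divides
  both \<open>r k\<close> and \<open>F_S k r\<close>.\<close>

definition N3 :: "nat \<Rightarrow> (nat \<Rightarrow> int) \<Rightarrow> int \<Rightarrow> int" where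
  "N3 k r n = Max ({0}
     \<union> {(int (min_len k r l) * r k + 3 * r k) div gcd_r k r | l. l \<in> P_low k r n})"

definition N :: "nat \<Rightarrow> (nat \<Rightarrow> int) \<Rightarrow> int \<Rightarrow> int" where
  "N k r n =
     Max {N0 k r + r k + F_S k r div gcd_r k r, N1 k r n, N2 k r n, N3 k r n}"

end

theory Submission
  imports Defs
begin

text \<open>
Write \<open>R = r k\<close>, \<open>T = S k r\<close>, \<open>M n = M k r n\<close>, and let \<open>m s\<close> be the least number of generators in a factorization
of \<open>s \<in> T\<close>. A sum of \<open>a\<close> generators of \<open>M n\<close> has the form \<open>a * n + s\<close>, so \<open>M n\<close> consists of the
numbers \<open>a * n + s\<close> with \<open>s \<in> T\<close> and \<open>m s \<le> a\<close> (\<open>M_iff\<close>): everything about \<open>M n\<close> is governed by the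
one function \<open>m\<close>, which does not depend on \<open>n\<close>.

By the pigeonhole principle, a shortest factorization contains fewer than \<open>R\<close> generators other than
\<open>R\<close> itself, since \<open>R\<close> of them would contain a nonempty subfamily whose sum is a multiple of \<open>R\<close>,
which fewer copies of \<open>R\<close> could replace (\<open>few_small_generators\<close>). Hence \<open>m s\<close> differs from \<open>s / R\<close>
by less than \<open>R\<close>, so that \<open>m\<close> does not decrease under shifts by at least \<open>R^2\<close>, and
\<open>m (s + R) = m s + 1\<close> for all \<open>s\<close> from about \<open>R^2\<close> on.

For \<open>n\<close> above the bound this describes the pseudo-Frobenius numbers: they are
\<open>i + (m i - 1) * n\<close>, where \<open>i\<close> runs through the elements of the Apery set \<open>Ap n\<close> from which no step
\<open>i + r j\<close> inside \<open>Ap n\<close> increases \<open>m\<close> (\<open>PF_iff\<close>, \<open>P_iff\<close>). Such an index \<open>i\<close> is either low, in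
which case \<open>i + R < R^2\<close> and the condition on \<open>i\<close> does not mention \<open>n\<close>, or it lies in the range
where \<open>m\<close> is quasi-linear, and then the whole situation is translated by \<open>d * R\<close> when \<open>n\<close> is
replaced by \<open>n + R\<close>. Hence \<open>psi\<close> maps the indices for \<open>n\<close> onto those for \<open>n + R\<close> (\<open>P_step\<close>), and
\<open>phi\<close> is the induced map (\<open>phi_lift_PF\<close>).

In terms of indices, the condition on an NG-vector says that
\<open>x + a * n \<in> M n\<close> for \<open>x = r j + i - l\<close> and \<open>a = m i - m l + 1\<close>, and this means
\<open>m (x + q * d * n) + q * d \<le> a\<close> for some \<open>q\<close> (\<open>M_membership\<close>). If \<open>i\<close> and \<open>l\<close> are both low or both
high, then \<open>x\<close> and \<open>a\<close> do not change under \<open>psi\<close>, and the bounds on \<open>n\<close> force \<open>q = 0\<close>, which makes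
the condition independent of \<open>n\<close>. If \<open>i\<close> is low and \<open>l\<close> is high, the condition never holds,
because \<open>x + a * n < 0\<close>. If \<open>i\<close> is high and \<open>l\<close> is low, then \<open>x\<close> and \<open>a\<close> grow by \<open>d * R\<close> and \<open>d\<close>,
and the condition survives (\<open>compatible_step\<close>). The inequalities on \<open>n\<close> used here are themselves
preserved by \<open>n \<mapsto> n + R\<close>, so the step can be iterated. The statement on near Gorensteinness follows
from the one on NG-vectors by the theorem of Moscariello and Strazzanti
(\<open>nearly_gorenstein_iff_NG_vector\<close>), which holds because the canonical ideal is generated by the
differences \<open>frobenius H - f\<close> with \<open>f \<in> PF H\<close>.
\<close>

section \<open>Preliminaries\<close>

lemma Greatest_int_bounded:
  fixes Q :: "int \<Rightarrow> bool"
  assumes "Q x0" and "\<And>y. Q y \<Longrightarrow> y \<le> B"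
  shows "Q (Greatest Q)" and "\<And>y. Q y \<Longrightarrow> y \<le> Greatest Q"
proof -
  let ?A = "{y. Q y \<and> x0 \<le> y}"
  have fin: "finite ?A"
    by (rule finite_subset[of _ "{x0..B}"]) (use assms(2) in auto)
  have ne: "?A \<noteq> {}" using assms(1) by auto
  have QM: "Q (Max ?A)" using Max_in[OF fin ne] by simp
  have le: "y \<le> Max ?A" if "Q y" for y
  proof (cases "x0 \<le> y")
    case True
    then show ?thesis using that fin by simp
  next
    case False
    then show ?thesis using Max_ge[OF fin, of x0] assms(1) by simp
  qed
  have eq: "Greatest Q = Max ?A"
    using QM le by (intro Greatest_equality) auto
  show "Q (Greatest Q)" and "\<And>y. Q y \<Longrightarrow> y \<le> Greatest Q"
    using QM le by (simp_all add: eq)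
qed

text \<open>A vector \<open>c\<close> of multiplicities can be built up one unit at a time. Differences of two members of
such a chain are subfamilies of \<open>c\<close>; the pigeonhole principle will be applied to their sums.\<close>

lemma exists_chain:
  fixes c :: "nat \<Rightarrow> nat"
  assumes "finite I" "L \<le> sum c I"
  shows "\<exists>g :: nat \<Rightarrow> nat \<Rightarrow> nat. (\<forall>t\<le>L. \<forall>j\<in>I. g t j \<le> c j) \<and>
    (\<forall>t<L. \<forall>j. g t j \<le> g (Suc t) j) \<and> (\<forall>t\<le>L. sum (g t) I = t)"
  using assms(2)
proof (induction L)
  case 0
  show ?case by (rule exI[of _ "\<lambda>_ _. 0"]) simp
next
  case (Suc L)
  then obtain g where g: "\<And>t j. t \<le> L \<Longrightarrow> j \<in> I \<Longrightarrow> g t j \<le> c j"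
    "\<And>t j. t < L \<Longrightarrow> g t j \<le> g (Suc t) j" "\<And>t. t \<le> L \<Longrightarrow> sum (g t) I = t"
    by (metis Suc_leD)
  have "\<exists>j\<in>I. g L j < c j"
  proof (rule ccontr)
    assume "\<not> ?thesis"
    then have "sum c I \<le> sum (g L) I" by (intro sum_mono) auto
    then show False using g(3)[of L] Suc.prems by simp
  qed
  then obtain j where j: "j \<in> I" "g L j < c j" by blast
  define u where "u = (g L)(j := Suc (g L j))"
  have "sum u I = Suc L"
  proof -
    have "sum u I = u j + sum u (I - {j})" by (rule sum.remove[OF assms(1) j(1)])
    also have "sum u (I - {j}) = sum (g L) (I - {j})" by (intro sum.cong) (auto simp: u_def)
    also have "u j + sum (g L) (I - {j}) = Suc (sum (g L) I)"
      by (simp add: u_def sum.remove[OF assms(1) j(1)])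
    finally show ?thesis using g(3)[of L] by simp
  qed
  moreover have "u i \<le> c i" if "i \<in> I" for i using g(1)[of L i] j that by (auto simp: u_def)
  moreover have "g L i \<le> u i" for i by (simp add: u_def)
  ultimately show ?case
    using g by (intro exI[of _ "g(Suc L := u)"]) (auto simp: le_Suc_eq less_Suc_eq)
qed

lemma Gcd_in_subgroup:
  fixes A :: "int set"
  assumes "finite A" "A \<subseteq> D" "0 \<in> D" "\<And>x y. x \<in> D \<Longrightarrow> y \<in> D \<Longrightarrow> x + y \<in> D"
    "\<And>x q. x \<in> D \<Longrightarrow> q * x \<in> D"
  shows "Gcd A \<in> D"
  using assms(1,2)
proof (induction A rule: finite_induct)
  case empty
  show ?case using assms(3) by simp
next
  case (insert a A)
  obtain u v where "u * a + v * Gcd A = gcd a (Gcd A)" using bezout_int by blast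
  moreover have "u * a + v * Gcd A \<in> D" using insert assms(4,5) by auto
  ultimately show ?case by simp
qed

lemma gen_monoidI: "(\<Sum>i\<in>I. int (c i) * a i) \<in> gen_monoid I a"
  by (auto simp: gen_monoid_def)

lemma gen_monoid_zero: "0 \<in> gen_monoid I a"
  using gen_monoidI[of "\<lambda>_. 0" a I] by simp

lemma gen_monoid_add:
  assumes "x \<in> gen_monoid I a" "y \<in> gen_monoid I a"
  shows "x + y \<in> gen_monoid I a"
proof -
  obtain c e where "x = (\<Sum>i\<in>I. int (c i) * a i)" "y = (\<Sum>i\<in>I. int (e i) * a i)"
    using assms by (auto simp: gen_monoid_def)
  then have "x + y = (\<Sum>i\<in>I. int (c i + e i) * a i)"
    by (simp add: sum.distrib algebra_simps)
  then show ?thesis using gen_monoidI[of "\<lambda>i. c i + e i"] by simp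
qed

lemma gen_monoid_generator:
  assumes "finite I" "i \<in> I"
  shows "a i \<in> gen_monoid I a"
proof -
  have "(\<Sum>j\<in>I. int (if j = i then 1 else 0) * a j) = (\<Sum>j\<in>I. if j = i then a j else 0)"
    by (intro sum.cong) auto
  then have "(\<Sum>j\<in>I. int (if j = i then 1 else 0) * a j) = a i"
    using assms by simp
  then show ?thesis using gen_monoidI[of "\<lambda>j. if j = i then 1 else 0" a I] by metis
qed

lemma gen_monoid_split:
  assumes fin: "finite I" and z: "z \<in> gen_monoid I a" "z \<noteq> 0"
  obtains i where "i \<in> I" "z - a i \<in> gen_monoid I a"
proof -
  obtain c where c: "z = (\<Sum>i\<in>I. int (c i) * a i)" using z by (auto simp: gen_monoid_def)
  then obtain i where i: "i \<in> I" "c i \<noteq> 0"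
    using z(2) by (metis (no_types, lifting) mult_zero_left of_nat_0 sum.neutral)
  have "z = int (c i) * a i + (\<Sum>j\<in>I - {i}. int (c j) * a j)"
    unfolding c by (rule sum.remove[OF fin i(1)])
  moreover have "(\<Sum>j\<in>I. int ((c(i := c i - 1)) j) * a j)
      = int (c i - 1) * a i + (\<Sum>j\<in>I - {i}. int (c j) * a j)"
    by (subst sum.remove[OF fin i(1)]) (auto intro!: sum.cong)
  ultimately have "z - a i = (\<Sum>j\<in>I. int ((c(i := c i - 1)) j) * a j)"
    using i(2) by (simp add: of_nat_diff algebra_simps)
  then have "z - a i \<in> gen_monoid I a" using gen_monoidI[of "c(i := c i - 1)" a I] by simp
  then show ?thesis using that i(1) by blast
qed

section \<open>Numerical semigroups and NG-vectors\<close>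

lemma frobenius_notin:
  assumes "numerical_semigroup H"
  shows "frobenius H \<notin> H" and "\<And>x. x \<notin> H \<Longrightarrow> x \<le> frobenius H"
proof -
  have fin: "finite ({0..} - H)" and neg: "-1 \<notin> H"
    using assms by (auto simp: numerical_semigroup_def)
  have bound: "x \<le> Max (insert (-1) ({0..} - H))" if "x \<notin> H" for x
  proof (cases "0 \<le> x")
    case True
    then show ?thesis using fin that by (intro Max_ge) auto
  next
    case False
    then have "x \<le> -1" by simp
    also have "-1 \<le> Max (insert (-1) ({0..} - H))" using fin by (intro Max_ge) auto
    finally show ?thesis .
  qed
  show "frobenius H \<notin> H" and "\<And>x. x \<notin> H \<Longrightarrow> x \<le> frobenius H"
    unfolding frobenius_def
    using Greatest_int_bounded[where Q = "\<lambda>x. x \<notin> H", OF neg bound] by auto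
qed

text \<open>Pseudo-Frobenius numbers are the maximal gaps of \<open>H\<close> for the order \<open>x \<le> y \<longleftrightarrow> y - x \<in> H\<close>; as the gaps
are bounded above, there is a maximal one above each of them.\<close>

lemma PF_above:
  assumes H: "numerical_semigroup H" and z: "z \<notin> H"
  obtains f where "f \<in> PF H" "f - z \<in> H"
proof -
  let ?A = "{h \<in> H. z + h \<notin> H}"
  have "h \<le> frobenius H - z" if "h \<in> ?A" for h
    using frobenius_notin(2)[OF H, of "z + h"] that by simp
  then have "?A \<subseteq> {0..frobenius H - z}"
    using H by (auto simp: numerical_semigroup_def)
  then have fin: "finite ?A" by (rule finite_subset) simp
  have ne: "?A \<noteq> {}" using H z by (auto simp: numerical_semigroup_def intro: exI[of _ 0])
  define h where "h = Max ?A"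
  have h: "h \<in> H" "z + h \<notin> H"
    using Max_in[OF fin ne] by (simp_all add: h_def)
  have "z + h + g \<in> H" if "g \<in> H" "g \<noteq> 0" for g
  proof (rule ccontr)
    assume "z + h + g \<notin> H"
    then have "h + g \<in> ?A"
      using H h that by (auto simp: numerical_semigroup_def add.assoc)
    then have "h + g \<le> h" unfolding h_def by (rule Max_ge[OF fin])
    moreover have "0 \<le> g" using H that by (auto simp: numerical_semigroup_def)
    ultimately show False using that by simp
  qed
  then have "z + h \<in> PF H" using h by (simp add: PF_def)
  then show ?thesis using h that by auto
qed

text \<open>\<open>x\<close> lies in the canonical ideal if and only if \<open>frobenius H - x\<close> is a gap, and gaps lie below
pseudo-Frobenius numbers. So the elements \<open>frobenius H - f\<close> generate the canonical ideal.\<close>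

lemma canonical_ideal_iff:
  assumes H: "numerical_semigroup H"
  shows "x \<in> canonical_ideal H \<longleftrightarrow> (\<exists>f\<in>PF H. \<exists>h\<in>H. x = frobenius H - f + h)"
proof
  assume "x \<in> canonical_ideal H"
  then obtain f where "f \<in> PF H" "f - (frobenius H - x) \<in> H"
    using PF_above[OF H] by (auto simp: canonical_ideal_def)
  then show "\<exists>f\<in>PF H. \<exists>h\<in>H. x = frobenius H - f + h"
    by (intro bexI[of _ f] bexI[of _ "f - (frobenius H - x)"]) auto
next
  assume "\<exists>f\<in>PF H. \<exists>h\<in>H. x = frobenius H - f + h"
  then obtain f h where f: "f \<in> PF H" and h: "h \<in> H" and x: "x = frobenius H - f + h"
    by blast
  have "f - h \<notin> H"
  proof
    assume "f - h \<in> H"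
    then have "(f - h) + h \<in> H" using H h unfolding numerical_semigroup_def by blast
    then show False using f by (simp add: PF_def)
  qed
  moreover have "f \<le> frobenius H" using f frobenius_notin(2)[OF H] by (simp add: PF_def)
  moreover have "0 \<le> h" using H h by (auto simp: numerical_semigroup_def)
  ultimately show "x \<in> canonical_ideal H" by (simp add: canonical_ideal_def x)
qed

lemma ideal_diff_canonical_iff:
  assumes H: "numerical_semigroup H"
  shows "y \<in> ideal_diff H (canonical_ideal H) \<longleftrightarrow> (\<forall>f\<in>PF H. y + frobenius H - f \<in> H)"
proof
  assume y: "y \<in> ideal_diff H (canonical_ideal H)"
  show "\<forall>f\<in>PF H. y + frobenius H - f \<in> H"
  proof
    fix f assume "f \<in> PF H"
    then have "frobenius H - f \<in> canonical_ideal H"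
      using H by (simp add: canonical_ideal_iff[OF H], intro bexI[of _ f] bexI[of _ 0]) (auto simp: numerical_semigroup_def)
    then show "y + frobenius H - f \<in> H"
      using y by (auto simp: ideal_diff_def add_diff_eq)
  qed
next
  assume y: "\<forall>f\<in>PF H. y + frobenius H - f \<in> H"
  have "y + (frobenius H - f + h) \<in> H" if "f \<in> PF H" "h \<in> H" for f h
  proof -
    have "(y + frobenius H - f) + h \<in> H"
      using H y that unfolding numerical_semigroup_def by blast
    then show ?thesis by (simp add: algebra_simps)
  qed
  then show "y \<in> ideal_diff H (canonical_ideal H)"
    by (auto simp: ideal_diff_def canonical_ideal_iff[OF H])
qed

lemma frobenius_PF:
  assumes H: "numerical_semigroup H"
  shows "frobenius H \<in> PF H"
proof -
  have "frobenius H + h \<in> H" if "h \<in> H" "h \<noteq> 0" for h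
    using frobenius_notin(2)[OF H, of "frobenius H + h"] that H
    by (force simp: numerical_semigroup_def)
  then show ?thesis using frobenius_notin(1)[OF H] by (simp add: PF_def)
qed

text \<open>The trace is an ideal, so it contains \<open>H - {0}\<close> once it contains each generator. If
\<open>h i = x + y\<close> with \<open>x = frobenius H - f + t\<close> in the canonical ideal, then
\<open>h i = t + (y + frobenius H - f)\<close> is a decomposition in \<open>H\<close>. Since \<open>h i\<close> is irreducible, one summand
vanishes; if it is \<open>t\<close>, then \<open>f\<close> is the entry sought. Conversely, an entry \<open>f\<close> yields the decomposition
\<open>h i = (frobenius H - f) + (h i - frobenius H + f)\<close> required for the trace.\<close>

lemma nearly_gorenstein_iff_NG_vector:
  assumes H: "numerical_semigroup H" and min: "minimally_generated H k h"
    and nz: "\<And>i. i \<le> k \<Longrightarrow> h i \<noteq> 0"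
    and irred: "\<And>i u v. i \<le> k \<Longrightarrow> u \<in> H \<Longrightarrow> v \<in> H \<Longrightarrow> u + v = h i \<Longrightarrow> u = 0 \<or> v = 0"
  shows "nearly_gorenstein H \<longleftrightarrow> (\<exists>f. NG_vector H k h f)"
proof
  let ?F = "frobenius H" and ?K = "canonical_ideal H"
  have gen: "H = gen_monoid {..k} h" using min by (simp add: minimally_generated_def)
  have hin: "h i \<in> H" if "i \<le> k" for i
    unfolding gen using gen_monoid_generator[of "{..k}" i h] that by simp
  have nonneg: "0 \<le> x" if "x \<in> H" for x using H that by (auto simp: numerical_semigroup_def)
  assume NG: "nearly_gorenstein H"
  have "\<exists>f\<in>PF H. \<forall>g\<in>PF H. h i + f - g \<in> H" if i: "i \<le> k" for i
  proof -
    have "h i \<in> trace_ideal H" using NG hin[OF i] nz[OF i] by (auto simp: nearly_gorenstein_def)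
    then obtain x y where x: "x \<in> ?K" and y: "y \<in> ideal_diff H ?K" and xy: "h i = x + y"
      by (auto simp: trace_ideal_def)
    obtain f t where f: "f \<in> PF H" and t: "t \<in> H" and xeq: "x = ?F - f + t"
      using x canonical_ideal_iff[OF H] by blast
    have yF: "y + ?F - g \<in> H" if "g \<in> PF H" for g
      using y that ideal_diff_canonical_iff[OF H] by blast
    consider "t = 0" | "y + ?F - f = 0"
      using irred[OF i t yF[OF f]] xy xeq by auto
    then show ?thesis
    proof cases
      case 1
      then have eq: "h i + f - g = y + ?F - g" for g using xy xeq by simp
      show ?thesis using yF by (intro bexI[OF _ f]) (simp only: eq ball_simps, blast)
    next
      case 2
      \<comment> \<open>Here \<open>y = 0\<close>, so \<open>K \<subseteq> H\<close>: the semigroup is symmetric and the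
        Frobenius number itself works for every generator.\<close>
      have "0 \<le> y" using yF[OF frobenius_PF[OF H]] nonneg by auto
      moreover have "f \<le> ?F" using f frobenius_notin(2)[OF H] by (simp add: PF_def)
      ultimately have "y = 0" using 2 by simp
      then have "?F - g \<in> H" if "g \<in> PF H" for g using yF[OF that] by simp
      then have "h i + (?F - g) \<in> H" if "g \<in> PF H" for g
        using that hin[OF i] H unfolding numerical_semigroup_def by blast
      then show ?thesis
        using frobenius_PF[OF H] by (intro bexI[of _ ?F]) (auto simp: add_diff_eq)
    qed
  qed
  then have "\<forall>i\<in>{..k}. \<exists>f. f \<in> PF H \<and> (\<forall>g\<in>PF H. h i + f - g \<in> H)" by auto
  then obtain f where "\<forall>i\<in>{..k}. f i \<in> PF H \<and> (\<forall>g\<in>PF H. h i + f i - g \<in> H)"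
    by (auto dest: bchoice)
  then show "\<exists>f. NG_vector H k h f" using H min by (auto simp: NG_vector_def)
next
  let ?F = "frobenius H" and ?K = "canonical_ideal H"
  have gen: "H = gen_monoid {..k} h" using min by (simp add: minimally_generated_def)
  assume "\<exists>f. NG_vector H k h f"
  then obtain f where f: "\<And>i. i \<le> k \<Longrightarrow> f i \<in> PF H"
    and NG: "\<And>i g. i \<le> k \<Longrightarrow> g \<in> PF H \<Longrightarrow> h i + f i - g \<in> H"
    by (auto simp: NG_vector_def)
  have "z \<in> trace_ideal H" if z: "z \<in> H" "z \<noteq> 0" for z
  proof -
    obtain i where i: "i \<le> k" and t: "z - h i \<in> H"
      using gen_monoid_split[of "{..k}" z h] z gen by auto
    have "?F - f i + (z - h i) \<in> ?K"
      using f[OF i] t canonical_ideal_iff[OF H] by blast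
    moreover have "h i - ?F + f i \<in> ideal_diff H ?K"
      using NG[OF i] by (auto simp: ideal_diff_canonical_iff[OF H])
    moreover have "z = (?F - f i + (z - h i)) + (h i - ?F + f i)" by simp
    ultimately show ?thesis unfolding trace_ideal_def by blast
  qed
  then show "nearly_gorenstein H" using H by (auto simp: nearly_gorenstein_def)
qed

section \<open>Factorization lengths in the unshifted semigroup\<close>

locale shift_data =
  fixes k :: nat and r :: "nat \<Rightarrow> int"
  assumes k_pos: "1 \<le> k" and r_zero: "r 0 = 0" and r_mono: "strict_mono_on {..k} r"
begin

abbreviation d :: int where "d \<equiv> gcd_r k r"
abbreviation R :: int where "R \<equiv> r k"
abbreviation T :: "int set" where "T \<equiv> S k r"
abbreviation F :: int where "F \<equiv> F_S k r"
abbreviation m :: "int \<Rightarrow> int" where "m s \<equiv> int (min_len k r s)"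

definition factors :: "int \<Rightarrow> nat \<Rightarrow> bool" where
  "factors s a \<longleftrightarrow> (\<exists>c::nat \<Rightarrow> nat. s = (\<Sum>j\<in>{1..k}. int (c j) * r j) \<and> a = (\<Sum>j\<in>{1..k}. c j))"

lemma r_less: "i < j \<Longrightarrow> j \<le> k \<Longrightarrow> r i < r j"
  using r_mono by (auto simp: strict_mono_on_def)

lemma r_pos: "1 \<le> j \<Longrightarrow> j \<le> k \<Longrightarrow> 0 < r j"
  using r_less[of 0 j] r_zero by simp

lemma r_le: "j \<le> k \<Longrightarrow> r j \<le> R"
  using r_less[of j k] by (cases "j = k") auto

lemma r_nonneg: "j \<le> k \<Longrightarrow> 0 \<le> r j"
  using r_pos[of j] r_zero by (cases "j = 0") auto

lemma R_pos: "0 < R"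
  using r_pos[OF k_pos] by simp

lemma R_le_square: "R \<le> R\<^sup>2"
  using R_pos by (simp add: power2_eq_square)

lemma d_dvd_r: "j \<le> k \<Longrightarrow> d dvd r j"
  using r_zero by (cases "j = 0") (auto simp: gcd_r_def intro!: Gcd_dvd)

lemma d_pos: "0 < d"
proof -
  have "0 \<le> d" unfolding gcd_r_def by simp
  moreover have "d \<noteq> 0" using d_dvd_r[of k] R_pos by auto
  ultimately show ?thesis by simp
qed

lemma T_iff: "s \<in> T \<longleftrightarrow> (\<exists>a. factors s a)"
  by (auto simp: S_def gen_monoid_def factors_def)

lemma min_len_factors: "s \<in> T \<Longrightarrow> factors s (min_len k r s)"
  unfolding min_len_def factors_def[symmetric] by (auto simp: T_iff intro: LeastI)

lemma min_len_le: "factors s a \<Longrightarrow> min_len k r s \<le> a"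
  unfolding min_len_def factors_def[symmetric] by (rule Least_le)

lemma factors_add: "factors s a \<Longrightarrow> factors t b \<Longrightarrow> factors (s + t) (a + b)"
proof -
  assume "factors s a" "factors t b"
  then obtain c e where
    "s = (\<Sum>j\<in>{1..k}. int (c j) * r j)" "a = (\<Sum>j\<in>{1..k}. c j)"
    "t = (\<Sum>j\<in>{1..k}. int (e j) * r j)" "b = (\<Sum>j\<in>{1..k}. e j)"
    by (auto simp: factors_def)
  then have "s + t = (\<Sum>j\<in>{1..k}. int (c j + e j) * r j) \<and> a + b = (\<Sum>j\<in>{1..k}. c j + e j)"
    by (simp add: sum.distrib algebra_simps)
  then show ?thesis unfolding factors_def by (rule exI[of _ "\<lambda>j. c j + e j"])
qed

lemma factors_zero: "factors 0 0"
  unfolding factors_def by (rule exI[of _ "\<lambda>_. 0"]) simp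

lemma factors_generator:
  assumes "1 \<le> j" "j \<le> k"
  shows "factors (r j) 1"
proof -
  have "(\<Sum>i\<in>{1..k}. int (if i = j then 1 else 0) * r i) = (\<Sum>i\<in>{1..k}. if i = j then r i else 0)"
    by (intro sum.cong) auto
  then have "(\<Sum>i\<in>{1..k}. int (if i = j then 1 else 0) * r i) = r j"
    using assms by simp
  then show ?thesis using assms unfolding factors_def
    by (intro exI[of _ "\<lambda>i. if i = j then 1 else 0"]) (simp add: sum.delta)
qed

lemma T_add: "s \<in> T \<Longrightarrow> t \<in> T \<Longrightarrow> s + t \<in> T"
  unfolding T_iff using factors_add by blast

lemma T_zero: "0 \<in> T"
  unfolding T_iff using factors_zero by blast

lemma r_in_T: "j \<le> k \<Longrightarrow> r j \<in> T"
  using factors_generator[of j] T_zero r_zero by (cases "j = 0") (auto simp: T_iff)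

lemma T_mult: "s \<in> T \<Longrightarrow> 0 \<le> q \<Longrightarrow> q * s \<in> T"
proof -
  assume s: "s \<in> T" and q: "0 \<le> q"
  have "int a * s \<in> T" for a
    by (induction a) (simp_all add: T_zero T_add[OF s] algebra_simps)
  from this[of "nat q"] q show ?thesis by simp
qed

lemma min_len_add_r: "s \<in> T \<Longrightarrow> j \<le> k \<Longrightarrow> m (s + r j) \<le> m s + 1"
  using min_len_le[OF factors_add[OF min_len_factors[of s] factors_generator[of j]]] r_zero
  by (cases "j = 0") auto

lemma min_len_add_multiple_R: "s \<in> T \<Longrightarrow> 0 \<le> q \<Longrightarrow> m (s + q * R) \<le> m s + q"
proof -
  assume s: "s \<in> T" and q: "0 \<le> q"
  have "s + int a * R \<in> T \<and> m (s + int a * R) \<le> m s + int a" for a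
  proof (induction a)
    case 0
    show ?case using s by simp
  next
    case (Suc a)
    then show ?case
      using min_len_add_r[of "s + int a * R" k] T_add[of "s + int a * R" R] r_in_T[of k]
      by (simp add: algebra_simps)
  qed
  from this[of "nat q"] q show ?thesis by simp
qed

lemma factors_bounds:
  assumes "factors s a"
  shows "0 \<le> s" "d dvd s" "s \<le> int a * R"
proof -
  obtain c where c: "s = (\<Sum>j\<in>{1..k}. int (c j) * r j)" "a = (\<Sum>j\<in>{1..k}. c j)"
    using assms by (auto simp: factors_def)
  show "0 \<le> s" unfolding c by (intro sum_nonneg) (auto intro!: mult_nonneg_nonneg r_nonneg)
  show "d dvd s" unfolding c by (intro dvd_sum dvd_mult d_dvd_r) auto
  have "s \<le> (\<Sum>j\<in>{1..k}. int (c j) * R)"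
    unfolding c by (intro sum_mono mult_left_mono r_le) auto
  then show "s \<le> int a * R" by (simp add: c sum_distrib_right)
qed

lemma T_nonneg: "s \<in> T \<Longrightarrow> 0 \<le> s"
  using factors_bounds(1) T_iff by blast

lemma T_dvd: "s \<in> T \<Longrightarrow> d dvd s"
  using factors_bounds(2) T_iff by blast

lemma le_min_len: "s \<in> T \<Longrightarrow> s \<le> m s * R"
  using factors_bounds(3)[OF min_len_factors] .

text \<open>Build up the part of a shortest factorization without \<open>R\<close> one generator at a time. If there are
at least \<open>R\<close> steps, two partial sums are congruent modulo \<open>R\<close>. The generators between them, say
\<open>v - u\<close> many, have sum \<open>R * q\<close> with \<open>q < v - u\<close>, because each is smaller than \<open>R\<close>; so \<open>q\<close> copies of
\<open>R\<close> yield a shorter factorization.\<close>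

lemma few_small_generators:
  assumes s: "s \<in> T"
  obtains c :: "nat \<Rightarrow> nat" where "s = (\<Sum>j\<in>{1..k}. int (c j) * r j)"
    "min_len k r s = (\<Sum>j\<in>{1..k}. c j)" "int (\<Sum>j\<in>{1..<k}. c j) < R"
proof -
  obtain c where c: "s = (\<Sum>j\<in>{1..k}. int (c j) * r j)" "min_len k r s = (\<Sum>j\<in>{1..k}. c j)"
    using min_len_factors[OF s] by (auto simp: factors_def)
  have split: "{1..k} = insert k {1..<k}" using k_pos by auto
  have "int (\<Sum>j\<in>{1..<k}. c j) < R"
  proof (rule ccontr)
    assume "\<not> ?thesis"
    then have "nat R \<le> (\<Sum>j\<in>{1..<k}. c j)" by linarith
    then obtain g :: "nat \<Rightarrow> nat \<Rightarrow> nat" where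
      le: "\<And>t j. t \<le> nat R \<Longrightarrow> j \<in> {1..<k} \<Longrightarrow> g t j \<le> c j"
      and mono: "\<And>t j. t < nat R \<Longrightarrow> g t j \<le> g (Suc t) j"
      and size: "\<And>t. t \<le> nat R \<Longrightarrow> sum (g t) {1..<k} = t"
      using exists_chain[of "{1..<k}" "nat R" c] by (metis finite_atLeastLessThan)
    have mono': "g u j \<le> g v j" if "u \<le> v" "v \<le> nat R" for u v j
      using that by (induction v rule: dec_induct) (use mono in \<open>auto intro: order_trans\<close>)
    define w where "w t = (\<Sum>j\<in>{1..<k}. int (g t j) * r j)" for t
    have "(\<lambda>t. w t mod R) ` {0..nat R} \<subseteq> {0..<R}" using R_pos by auto
    then have "card ((\<lambda>t. w t mod R) ` {0..nat R}) \<le> card {0..<R}" by (intro card_mono) auto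
    then have "\<not> inj_on (\<lambda>t. w t mod R) {0..nat R}"
      by (intro pigeonhole) (use R_pos in auto)
    then obtain u v where uv: "u < v" "v \<le> nat R" "w u mod R = w v mod R"
      unfolding inj_on_def by (metis atLeastAtMost_iff linorder_neqE_nat)
    \<comment> \<open>\<open>e\<close> is the subfamily to be replaced by \<open>q\<close> copies of \<open>R\<close>, and \<open>c'\<close> the resulting factorization.\<close>
    define e where "e j = g v j - g u j" for j
    have wv: "w v - w u = (\<Sum>j\<in>{1..<k}. int (e j) * r j)"
      using mono'[of u v] uv unfolding w_def e_def
      by (simp add: sum_subtractf[symmetric] of_nat_diff left_diff_distrib)
    have se: "(\<Sum>j\<in>{1..<k}. e j) = v - u"
      using size[of u] size[of v] mono'[of u v] uv unfolding e_def
      by (subst sum_subtractf_nat) auto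
    have ec: "e j \<le> c j" if "j \<in> {1..<k}" for j
      using le[OF uv(2) that] by (simp add: e_def)
    obtain q where q: "w v - w u = R * q"
      using uv(3) by (metis dvd_def mod_eq_dvd_iff)
    have e_nonneg: "0 \<le> w v - w u"
      unfolding wv by (intro sum_nonneg) (auto intro!: mult_nonneg_nonneg r_nonneg)
    then have q0: "0 \<le> q" using q R_pos by (simp add: zero_le_mult_iff)
    obtain j0 where j0: "j0 \<in> {1..<k}" "0 < e j0"
      using se uv(1) by (metis gr0I sum.neutral zero_less_diff neq0_conv)
    have "w v - w u < (\<Sum>j\<in>{1..<k}. int (e j) * R)"
      unfolding wv
      by (rule sum_strict_mono_ex1) (use j0 r_less r_le in \<open>auto intro!: mult_left_mono bexI[of _ j0]\<close>)
    also have "\<dots> = int (v - u) * R" by (simp flip: sum_distrib_right se)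
    finally have ql: "q < int (v - u)" using q R_pos by (simp add: mult.commute)
    define c' where "c' j = (if j = k then c k + nat q else c j - e j)" for j
    have "(\<Sum>j\<in>{1..<k}. int (c' j) * r j) = (\<Sum>j\<in>{1..<k}. int (c j) * r j) - (w v - w u)"
      unfolding wv sum_subtractf[symmetric]
      by (intro sum.cong) (use ec in \<open>auto simp: c'_def of_nat_diff left_diff_distrib\<close>)
    then have s': "s = (\<Sum>j\<in>{1..k}. int (c' j) * r j)"
      using q q0 unfolding c(1) split by (simp add: c'_def algebra_simps)
    have "(\<Sum>j\<in>{1..<k}. c' j) = (\<Sum>j\<in>{1..<k}. c j) - (v - u)"
      unfolding se[symmetric] by (subst sum_subtractf_nat[symmetric]) (use ec in \<open>auto simp: c'_def\<close>)
    moreover have "v - u \<le> (\<Sum>j\<in>{1..<k}. c j)"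
      unfolding se[symmetric] by (intro sum_mono) (use ec in auto)
    ultimately have "(\<Sum>j\<in>{1..k}. c' j) < (\<Sum>j\<in>{1..k}. c j)"
      using ql q0 unfolding split by (simp add: c'_def)
    moreover have "factors s (\<Sum>j\<in>{1..k}. c' j)" using s' unfolding factors_def by blast
    ultimately show False using min_len_le c(2) by fastforce
  qed
  with c show ?thesis using that by blast
qed

lemma min_len_mult_R_le:
  assumes s: "s \<in> T"
  shows "m s * R \<le> s + R * (R - 1)"
proof -
  obtain c :: "nat \<Rightarrow> nat" where c: "s = (\<Sum>j\<in>{1..k}. int (c j) * r j)"
    "min_len k r s = (\<Sum>j\<in>{1..k}. c j)" "int (\<Sum>j\<in>{1..<k}. c j) < R"
    using few_small_generators[OF s] by blast
  have split: "{1..k} = insert k {1..<k}" using k_pos by auto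
  have "0 \<le> (\<Sum>j\<in>{1..<k}. int (c j) * r j)"
    by (intro sum_nonneg) (auto intro!: mult_nonneg_nonneg r_nonneg)
  then have "int (c k) * R \<le> s" unfolding c(1) split by simp
  moreover have "m s = int (c k) + int (\<Sum>j\<in>{1..<k}. c j)" unfolding c(2) split by simp
  moreover have "int (\<Sum>j\<in>{1..<k}. c j) * R \<le> (R - 1) * R"
    using c(3) R_pos by (intro mult_right_mono) auto
  ultimately show ?thesis by (simp add: algebra_simps)
qed

text \<open>Both lengths are close to the value divided by \<open>R\<close>: \<open>m s * R \<le> s + R * (R - 1)\<close>, while
\<open>m (s + t) * R \<ge> s + t\<close>.\<close>

lemma min_len_mono_shift:
  assumes "s \<in> T" "s + t \<in> T" "R\<^sup>2 \<le> t"
  shows "m s \<le> m (s + t)"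
proof -
  have "m s * R \<le> s + R * (R - 1)" by (rule min_len_mult_R_le[OF assms(1)])
  also have "\<dots> \<le> s + t" using assms(3) R_pos by (simp add: power2_eq_square algebra_simps)
  also have "\<dots> \<le> m (s + t) * R" by (rule le_min_len[OF assms(2)])
  finally show ?thesis using R_pos by simp
qed

text \<open>Fewer than \<open>R\<close> generators below \<open>R\<close> cannot add up to \<open>R^2\<close>, so a shortest factorization of \<open>s\<close>
contains \<open>R\<close>, and removing it leaves a shortest factorization.\<close>

lemma large_uses_R:
  assumes s: "s \<in> T" and large: "R\<^sup>2 \<le> s"
  shows "s - R \<in> T" "m s = m (s - R) + 1"
proof -
  obtain c :: "nat \<Rightarrow> nat" where c: "s = (\<Sum>j\<in>{1..k}. int (c j) * r j)"
    "min_len k r s = (\<Sum>j\<in>{1..k}. c j)" "int (\<Sum>j\<in>{1..<k}. c j) < R"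
    using few_small_generators[OF s] by blast
  have split: "{1..k} = insert k {1..<k}" using k_pos by auto
  have "c k \<noteq> 0"
  proof
    assume "c k = 0"
    then have "s = (\<Sum>j\<in>{1..<k}. int (c j) * r j)" unfolding c(1) split by simp
    also have "\<dots> \<le> (\<Sum>j\<in>{1..<k}. int (c j) * R)"
      by (intro sum_mono mult_left_mono r_le) auto
    also have "\<dots> = int (\<Sum>j\<in>{1..<k}. c j) * R" by (simp add: sum_distrib_right)
    also have "\<dots> < R * R" using c(3) R_pos by (intro mult_strict_right_mono) auto
    finally show False using large by (simp add: power2_eq_square)
  qed
  then obtain b where b: "c k = Suc b" using not0_implies_Suc by blast
  have len: "min_len k r s = Suc (b + (\<Sum>j\<in>{1..<k}. c j))"
    using c(2) unfolding split by (simp add: b)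
  have "factors (s - R) (b + (\<Sum>j\<in>{1..<k}. c j))"
    unfolding factors_def c(1) split by (rule exI[of _ "c(k := b)"]) (simp add: b algebra_simps)
  then have *: "s - R \<in> T" "min_len k r (s - R) < min_len k r s"
    using min_len_le[of "s - R"] len by (metis T_iff, metis le_imp_less_Suc)
  show "s - R \<in> T" by (rule *)
  have "m s \<le> m (s - R) + 1" using min_len_add_r[OF *(1), of k] by simp
  then show "m s = m (s - R) + 1" using *(2) by linarith
qed

lemma min_len_large_shift:
  assumes "s \<in> T" "0 \<le> q" "R\<^sup>2 \<le> s + R"
  shows "m (s + q * R) = m s + q"
proof -
  have "s + int a * R \<in> T \<and> m (s + int a * R) = m s + int a" for a
  proof (induction a)
    case 0
    show ?case using assms by simp
  next
    case (Suc a)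
    have 1: "s + int a * R + R \<in> T" using Suc T_add r_in_T by simp
    have "R\<^sup>2 \<le> s + int a * R + R" using assms(3) mult_nonneg_nonneg[of "int a" R] R_pos by linarith
    then show ?case using large_uses_R(2)[OF 1] Suc 1 by (simp add: algebra_simps)
  qed
  from this[of "nat q"] assms(2) show ?thesis by simp
qed

text \<open>The differences of elements of \<open>T\<close> form a group containing all generators, hence also their gcd,
say \<open>d = u - v\<close>. If \<open>v = 0\<close>, then \<open>d \<in> T\<close>; otherwise division with remainder by \<open>v / d\<close>
writes each large multiple of \<open>d\<close> as a nonnegative combination of \<open>u\<close> and \<open>v\<close>.\<close>

lemma T_contains_large:
  obtains B where "\<And>t. d dvd t \<Longrightarrow> B \<le> t \<Longrightarrow> t \<in> T"
proof -
  let ?D = "{u - v | u v. u \<in> T \<and> v \<in> T}"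
  have D_mult: "q * (u - v) \<in> ?D" if "u \<in> T" "v \<in> T" for q u v
  proof (cases "0 \<le> q")
    case True
    then show ?thesis using that by (auto simp: right_diff_distrib intro!: T_mult)
  next
    case False
    then have "q * (u - v) = (- q) * v - (- q) * u" by (simp add: algebra_simps)
    moreover have "(- q) * v \<in> T" "(- q) * u \<in> T" by (rule T_mult; use that False in simp)+
    ultimately show ?thesis by blast
  qed
  have "Gcd (r ` {1..k}) \<in> ?D"
  proof (rule Gcd_in_subgroup)
    show "r ` {1..k} \<subseteq> ?D" using r_in_T T_zero by force
    show "0 \<in> ?D" using T_zero by force
    show "x + y \<in> ?D" if xy: "x \<in> ?D" "y \<in> ?D" for x y
    proof -
      obtain u v u' v' where "x = u - v" "y = u' - v'" "u \<in> T" "v \<in> T" "u' \<in> T" "v' \<in> T"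
        using xy by blast
      then show ?thesis by (intro CollectI exI[of _ "u + u'"] exI[of _ "v + v'"]) (auto intro: T_add)
    qed
  qed (use D_mult in auto)
  then obtain u v where uv: "d = u - v" "u \<in> T" "v \<in> T" by (auto simp: gcd_r_def)
  obtain w where w: "v = d * w" using T_dvd[OF uv(3)] by blast
  have w0: "0 \<le> w" using T_nonneg[OF uv(3)] w d_pos by (simp add: zero_le_mult_iff)
  have "t \<in> T" if t: "d dvd t" "d * w\<^sup>2 \<le> t" for t
  proof -
    obtain x where x: "t = d * x" using t(1) by blast
    have wx: "w\<^sup>2 \<le> x" using t(2) x d_pos by simp
    show ?thesis
    proof (cases "w = 0")
      case True
      then have "t = x * u" using uv w x by simp
      then show ?thesis using T_mult[OF uv(2)] wx True by simp
    next
      case False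
      \<comment> \<open>With \<open>x = p * w + b\<close> and \<open>0 \<le> b < w \<le> p\<close>, one has \<open>x * d = (p - b) * v + b * u\<close>.\<close>
      define p b where "p = x div w" and "b = x mod w"
      have b: "0 \<le> b" "b < w" using False w0 by (auto simp: b_def)
      have u: "u = d + d * w" using uv(1) w by simp
      have "x = p * w + b" by (simp add: p_def b_def)
      have "w \<le> p"
        using zdiv_mono1[OF wx, of w] False w0 by (simp add: p_def power2_eq_square)
      have "(p - b) * v + b * u = d * (p * w + b)" unfolding u w by (simp add: algebra_simps)
      then have "t = (p - b) * v + b * u" using \<open>x = p * w + b\<close> x by simp
      moreover have "(p - b) * v \<in> T" "b * u \<in> T"
        using b \<open>w \<le> p\<close> uv by (auto intro!: T_mult)
      ultimately show ?thesis using T_add by simp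
    qed
  qed
  then show ?thesis using that by blast
qed

lemma F_properties: "F \<notin> T" "d dvd F" "\<And>t. d dvd t \<Longrightarrow> F < t \<Longrightarrow> t \<in> T"
  and F_ge: "- d \<le> F"
proof -
  obtain B where B: "\<And>t. d dvd t \<Longrightarrow> B \<le> t \<Longrightarrow> t \<in> T" using T_contains_large by blast
  let ?Q = "\<lambda>s. s \<notin> T \<and> [s = 0] (mod d)"
  have ex: "?Q (- d)" using T_nonneg[of "- d"] d_pos by (auto simp: cong_0_iff)
  have bd: "\<And>y. ?Q y \<Longrightarrow> y \<le> B" using B by (force simp: cong_0_iff)
  have "?Q F" and ge: "\<And>y. ?Q y \<Longrightarrow> y \<le> F"
    unfolding F_S_def using Greatest_int_bounded[of ?Q, OF ex bd] by auto
  then show "F \<notin> T" "d dvd F" by (auto simp: cong_0_iff)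
  show "- d \<le> F" using ge ex by blast
  show "\<And>t. d dvd t \<Longrightarrow> F < t \<Longrightarrow> t \<in> T" using ge by (force simp: cong_0_iff)
qed

section \<open>Elements of the shifted semigroups\<close>

text \<open>These inequalities follow from \<open>n > N0 k r + R + F div d\<close> (see \<open>above_N\<close>) and are visibly inherited
by \<open>n + R\<close>.\<close>

definition large_shift :: "int \<Rightarrow> bool" where
  "large_shift n \<longleftrightarrow> gcd n d = 1 \<and> R\<^sup>2 < n \<and> R\<^sup>2 + F < n \<and> F + 2 * R < n"

lemma large_shiftD:
  assumes "large_shift n"
  shows "coprime n d" "0 < n" "R < n" "n \<le> d * n" "R\<^sup>2 < d * n" "R\<^sup>2 + F < d * n" "F + 2 * R < d * n"
    "F + R < d * n" "F < d * n"
proof -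
  have n: "R\<^sup>2 < n" "R\<^sup>2 + F < n" "F + 2 * R < n" using assms by (auto simp: large_shift_def)
  show "coprime n d" using assms by (simp add: large_shift_def coprime_iff_gcd_eq_1)
  show 1: "0 < n" and "R < n" using n R_pos R_le_square by linarith+
  show 2: "n \<le> d * n" using mult_right_mono[of 1 d n] d_pos 1 by simp
  show "R\<^sup>2 < d * n" "R\<^sup>2 + F < d * n" "F + 2 * R < d * n" "F + R < d * n" "F < d * n"
    using n 2 R_pos by linarith+
qed

lemma large_shift_step:
  assumes "large_shift n"
  shows "large_shift (n + R)"
proof -
  obtain c where c: "R = d * c" using d_dvd_r[of k] by blast
  have "gcd (n + R) d = gcd n d"
    using gcd_add_mult[of d c n] unfolding c by (simp add: gcd.commute ac_simps)
  then show ?thesis using assms R_pos by (simp add: large_shift_def)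
qed

lemma M_iff:
  "z \<in> M k r n \<longleftrightarrow> (\<exists>a::nat. \<exists>s\<in>T. m s \<le> int a \<and> z = int a * n + s)"
proof -
  have split: "{..k} = insert 0 {1..k}" by auto
  have sum_eq: "(\<Sum>j\<in>{..k}. int (c j) * shifted_gens r n j) =
      int (c 0 + (\<Sum>j\<in>{1..k}. c j)) * n + (\<Sum>j\<in>{1..k}. int (c j) * r j)" for c
    unfolding split
    by (simp add: shifted_gens_def r_zero sum.distrib algebra_simps flip: sum_distrib_left)
  show ?thesis
  proof
    assume "z \<in> M k r n"
    then obtain c where z: "z = (\<Sum>j\<in>{..k}. int (c j) * shifted_gens r n j)"
      by (auto simp: M_def gen_monoid_def)
    have f: "factors (\<Sum>j\<in>{1..k}. int (c j) * r j) (\<Sum>j\<in>{1..k}. c j)"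
      unfolding factors_def by blast
    show "\<exists>a::nat. \<exists>s\<in>T. m s \<le> int a \<and> z = int a * n + s"
      unfolding z sum_eq
      using f trans_le_add2[OF min_len_le[OF f], of "c 0"] T_iff of_nat_le_iff by blast
  next
    assume "\<exists>a::nat. \<exists>s\<in>T. m s \<le> int a \<and> z = int a * n + s"
    then obtain a s where s: "s \<in> T" "m s \<le> int a" "z = int a * n + s" by blast
    obtain c where c: "s = (\<Sum>j\<in>{1..k}. int (c j) * r j)" "min_len k r s = (\<Sum>j\<in>{1..k}. c j)"
      using min_len_factors[OF s(1)] by (auto simp: factors_def)
    \<comment> \<open>The generator \<open>n\<close> itself has index \<open>0\<close>; it supplies the summands beyond \<open>m s\<close>.\<close>
    define e where "e = c(0 := a - min_len k r s)"
    have "(\<Sum>j\<in>{1..k}. int (e j) * r j) = s" "(\<Sum>j\<in>{1..k}. e j) = min_len k r s"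
      by (subst c(1), intro sum.cong; simp add: e_def) (subst c(2), intro sum.cong; simp add: e_def)
    then have "z = (\<Sum>j\<in>{..k}. int (e j) * shifted_gens r n j)"
      unfolding sum_eq using s by (simp add: e_def of_nat_diff)
    then show "z \<in> M k r n" using gen_monoidI[of e] by (simp add: M_def)
  qed
qed

lemma M_I: "s \<in> T \<Longrightarrow> m s \<le> a \<Longrightarrow> s + a * n \<in> M k r n"
  unfolding M_iff by (intro exI[of _ "nat a"] bexI[of _ s]) auto

lemma M_add: "x \<in> M k r n \<Longrightarrow> y \<in> M k r n \<Longrightarrow> x + y \<in> M k r n"
  unfolding M_def by (rule gen_monoid_add)

lemma M_generator: "j \<le> k \<Longrightarrow> n + r j \<in> M k r n"
  using gen_monoid_generator[of "{..k}" j "shifted_gens r n"] by (simp add: M_def shifted_gens_def)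

lemma M_split:
  assumes "z \<in> M k r n" "z \<noteq> 0"
  obtains j where "j \<le> k" "z - (n + r j) \<in> M k r n"
  using gen_monoid_split[of "{..k}" z "shifted_gens r n"] assms
  by (auto simp: M_def shifted_gens_def)

lemma M_lower:
  assumes "0 < n" "z \<in> M k r n" "z \<noteq> 0"
  shows "n \<le> z"
proof -
  obtain a s where s: "s \<in> T" "m s \<le> int a" "z = int a * n + s"
    using assms(2) by (auto simp: M_iff)
  have "a \<noteq> 0"
  proof
    assume "a = 0"
    then have "s = 0" using s le_min_len[of s] T_nonneg[of s] by simp
    then show False using s \<open>a = 0\<close> assms(3) by simp
  qed
  then have "1 * n \<le> int a * n" using assms(1) by (intro mult_right_mono) auto
  then show ?thesis using s T_nonneg[of s] by simp
qed

text \<open>For \<open>x\<close> divisible by \<open>d\<close>, the elements of \<open>T\<close> congruent to \<open>x\<close> modulo \<open>n\<close> are of the form \<open>x + q * d * n\<close>, since all elements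
of \<open>T\<close> are divisible by \<open>d\<close>, which is coprime to \<open>n\<close>. Replacing \<open>x\<close> by \<open>x + q * d * n\<close> uses up
\<open>q * d\<close> of the \<open>a\<close> summands \<open>n\<close>.\<close>

lemma M_membership:
  assumes n: "large_shift n" and x: "d dvd x"
  shows "x + a * n \<in> M k r n \<longleftrightarrow> (\<exists>q. x + q * (d * n) \<in> T \<and> m (x + q * (d * n)) + q * d \<le> a)"
proof
  assume "x + a * n \<in> M k r n"
  then obtain b s where s: "s \<in> T" "m s \<le> int b" "x + a * n = int b * n + s"
    by (auto simp: M_iff)
  have sx: "s - x = (a - int b) * n" using s(3) by (simp add: algebra_simps)
  moreover have "d dvd s - x" using T_dvd[OF s(1)] x by simp
  ultimately have "d dvd a - int b"
    using large_shiftD(1)[OF n] by (simp add: coprime_commute coprime_dvd_mult_left_iff)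
  then obtain q where q: "a - int b = q * d" by (metis dvdE mult.commute)
  then have "s = x + q * (d * n)" using sx by (simp add: algebra_simps)
  then show "\<exists>q. x + q * (d * n) \<in> T \<and> m (x + q * (d * n)) + q * d \<le> a"
    using s q by (intro exI[of _ q]) auto
next
  assume "\<exists>q. x + q * (d * n) \<in> T \<and> m (x + q * (d * n)) + q * d \<le> a"
  then obtain q where q: "x + q * (d * n) \<in> T" "m (x + q * (d * n)) \<le> a - q * d" by auto
  show "x + a * n \<in> M k r n" using M_I[OF q, of n] by (simp add: algebra_simps)
qed

lemma min_len_mono_period:
  assumes n: "large_shift n" and "s \<in> T" "s + q * (d * n) \<in> T" "0 \<le> q"
  shows "m s \<le> m (s + q * (d * n))"
proof (cases "q = 0")
  case False
  then have "1 * (d * n) \<le> q * (d * n)"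
    using assms large_shiftD(2,4)[OF n] by (intro mult_right_mono) auto
  then show ?thesis using min_len_mono_shift assms large_shiftD(5)[OF n] by simp
qed simp

text \<open>As \<open>d\<close> is coprime to \<open>n\<close>, each residue class modulo \<open>n\<close> contains an element \<open>t \<in> T\<close> below the
common bound \<open>C\<close>, and \<open>t + a * n\<close> belongs to \<open>M n\<close> as soon as \<open>a \<ge> C\<close>, because \<open>m t \<le> t\<close>.\<close>

lemma numerical_semigroup_M:
  assumes n: "large_shift n"
  shows "numerical_semigroup (M k r n)"
proof -
  note n0 = large_shiftD(2)[OF n]
  obtain B where B: "\<And>t. d dvd t \<Longrightarrow> B \<le> t \<Longrightarrow> t \<in> T" using T_contains_large by blast
  define C where "C = d * (\<bar>B\<bar> + n)"
  have "z \<in> M k r n" if z: "C * (n + 1) \<le> z" for z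
  proof -
    obtain u where u: "[d * u = z] (mod n)"
      using cong_solve_coprime_int[of d n] large_shiftD(1)[OF n]
      by (metis coprime_commute cong_scalar_right mult.assoc mult.commute mult_1)
    define t where "t = d * (\<bar>B\<bar> + (u - \<bar>B\<bar>) mod n)"
    have md: "0 \<le> (u - \<bar>B\<bar>) mod n" "(u - \<bar>B\<bar>) mod n < n" using n0 by auto
    have "\<bar>B\<bar> \<le> t" unfolding t_def
      using mult_mono[of 1 d "\<bar>B\<bar>" "\<bar>B\<bar> + (u - \<bar>B\<bar>) mod n"] md d_pos by simp
    then have tT: "t \<in> T" by (intro B) (auto simp: t_def)
    have tC: "t \<le> C" unfolding t_def C_def using md d_pos by simp
    have "[t = d * u] (mod n)" unfolding t_def
      by (intro cong_scalar_left) (simp add: cong_def mod_simps)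
    then have "[z = t] (mod n)" using u by (meson cong_sym cong_trans)
    then obtain a where a: "z = t + a * n"
      by (metis cong_iff_lin mult.commute cong_sym)
    have "m t \<le> t"
    proof -
      obtain c where c: "t = (\<Sum>j\<in>{1..k}. int (c j) * r j)" "min_len k r t = (\<Sum>j\<in>{1..k}. c j)"
        using min_len_factors[OF tT] by (auto simp: factors_def)
      have "(\<Sum>j\<in>{1..k}. int (c j) * 1) \<le> (\<Sum>j\<in>{1..k}. int (c j) * r j)"
        by (intro sum_mono mult_left_mono) (use r_pos in force)+
      then show ?thesis using c by simp
    qed
    moreover have "C * n \<le> a * n" using z a tC by (simp add: algebra_simps)
    then have "C \<le> a" using n0 by simp
    ultimately show ?thesis unfolding a using tC by (intro M_I tT) simp
  qed
  then have "{0..} - M k r n \<subseteq> {0..<C * (n + 1)}" by (meson DiffE atLeastLessThan_iff atLeast_iff linorder_not_less subsetI)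
  then have "finite ({0..} - M k r n)" by (rule finite_subset) simp
  moreover have "M k r n \<subseteq> {0..}" using M_lower[OF n0] n0 by (metis atLeast_iff order.refl order.strict_implies_order order_trans subsetI)
  moreover have "0 \<in> M k r n" unfolding M_def by (rule gen_monoid_zero)
  ultimately show ?thesis using M_add by (simp add: numerical_semigroup_def)
qed

text \<open>Two nonzero elements have sum at least \<open>2 * n\<close>, which exceeds the largest generator \<open>n + R\<close>.\<close>

lemma M_irreducible:
  assumes n: "large_shift n" and "j \<le> k" "u \<in> M k r n" "v \<in> M k r n" "u + v = shifted_gens r n j"
  shows "u = 0 \<or> v = 0"
proof (rule ccontr)
  assume "\<not> ?thesis"
  then have "n \<le> u" "n \<le> v" using M_lower large_shiftD(2)[OF n] assms by blast+
  then show False using assms(5) r_le[OF assms(2)] large_shiftD(3)[OF n] by (simp add: shifted_gens_def)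
qed

lemma M_minimally_generated:
  assumes n: "large_shift n"
  shows "minimally_generated (M k r n) k (shifted_gens r n)"
proof -
  have "gen_monoid J (shifted_gens r n) \<noteq> M k r n" if J: "J \<subset> {..k}" for J
  proof
    assume eq: "gen_monoid J (shifted_gens r n) = M k r n"
    have fin: "finite J" using J finite_subset by blast
    obtain j where j: "j \<le> k" "j \<notin> J" using J by auto
    have gj: "shifted_gens r n j \<in> gen_monoid J (shifted_gens r n)"
      using M_generator[OF j(1)] eq by (simp add: shifted_gens_def)
    have nz: "shifted_gens r n i \<noteq> 0" if "i \<le> k" for i
      using r_nonneg[OF that] large_shiftD(2)[OF n] by (simp add: shifted_gens_def)
    obtain i where i: "i \<in> J" "shifted_gens r n j - shifted_gens r n i \<in> M k r n"
      using gen_monoid_split[OF fin gj nz[OF j(1)]] eq by auto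
    have ik: "i \<le> k" using i J by auto
    have "shifted_gens r n j - shifted_gens r n i = 0"
      using M_irreducible[OF n j(1) i(2), of "shifted_gens r n i"] nz[OF ik] M_generator[OF ik]
      by (simp add: shifted_gens_def)
    then have "r i = r j" by (simp add: shifted_gens_def)
    then show False using r_less[of i j] r_less[of j i] j i ik by (metis less_irrefl linorder_neqE_nat)
  qed
  moreover have "strict_mono_on {..k} (shifted_gens r n)"
    using r_mono by (simp add: strict_mono_on_def shifted_gens_def)
  ultimately show ?thesis by (auto simp: minimally_generated_def M_def)
qed

lemma nearly_gorenstein_M_iff:
  assumes n: "large_shift n"
  shows "nearly_gorenstein (M k r n) \<longleftrightarrow> (\<exists>f. NG_vector (M k r n) k (shifted_gens r n) f)"
proof (rule nearly_gorenstein_iff_NG_vector[OF numerical_semigroup_M[OF n] M_minimally_generated[OF n]])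
  show "shifted_gens r n i \<noteq> 0" if "i \<le> k" for i
    using r_nonneg[OF that] large_shiftD(2)[OF n] by (simp add: shifted_gens_def)
qed (rule M_irreducible[OF n])

section \<open>Apery set and pseudo-Frobenius numbers\<close>

abbreviation Ap :: "int \<Rightarrow> int set" where "Ap n \<equiv> Ap_S k r n"

lemma Ap_bounds:
  assumes "i \<in> Ap n"
  shows "i \<in> T" "i \<le> d * n + F"
proof -
  show "i \<in> T" using assms by (simp add: Ap_S_def)
  then show "i \<le> d * n + F" using assms F_properties(3)[of "i - d * n"] T_dvd[of i]
    by (force simp: Ap_S_def)
qed

lemma small_in_Ap: "i \<in> T \<Longrightarrow> i < d * n \<Longrightarrow> i \<in> Ap n"
  using T_nonneg[of "i - d * n"] by (auto simp: Ap_S_def)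

lemma Ap_minimal:
  assumes n: "large_shift n" and i: "i \<in> Ap n" and q: "i + q * (d * n) \<in> T"
  shows "0 \<le> q"
proof (rule ccontr)
  assume "\<not> 0 \<le> q"
  then have "(- q - 1) * (d * n) \<in> T"
    using large_shiftD(9)[OF n] F_properties(3)[of "d * n"] by (intro T_mult[of "d * n" "- q - 1"]) auto
  from T_add[OF q this] have "i - d * n \<in> T" by (simp add: algebra_simps)
  then show False using i by (simp add: Ap_S_def)
qed

text \<open>Thus \<open>i + m i * n\<close> is the least element of \<open>M n\<close> in its residue class modulo \<open>n\<close>: the numbers
\<open>i + m i * n\<close> with \<open>i \<in> Ap n\<close> form the Apery set of \<open>M n\<close> with respect to \<open>n\<close>.\<close>

lemma Ap_M_iff:
  assumes n: "large_shift n" and i: "i \<in> Ap n"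
  shows "i + a * n \<in> M k r n \<longleftrightarrow> m i \<le> a"
proof
  note iT = Ap_bounds(1)[OF i]
  assume "i + a * n \<in> M k r n"
  then obtain q where q: "i + q * (d * n) \<in> T" "m (i + q * (d * n)) + q * d \<le> a"
    using M_membership[OF n T_dvd[OF iT]] by blast
  have q0: "0 \<le> q" using Ap_minimal[OF n i q(1)] .
  have "m i \<le> m (i + q * (d * n))" using min_len_mono_period[OF n iT q(1) q0] .
  moreover have "0 \<le> q * d" using q0 d_pos by simp
  ultimately show "m i \<le> a" using q(2) by linarith
next
  assume "m i \<le> a"
  then show "i + a * n \<in> M k r n" using M_I[OF Ap_bounds(1)[OF i]] by blast
qed

lemma T_descend_to_Ap:
  assumes n: "large_shift n" and s: "s \<in> T"
  obtains i q where "i \<in> Ap n" "s = i + q * (d * n)" "0 \<le> q"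
proof -
  have "\<exists>i q. i \<in> Ap n \<and> s = i + q * (d * n) \<and> 0 \<le> q"
    using s
  proof (induction "nat s" arbitrary: s rule: less_induct)
    case less
    show ?case
    proof (cases "s - d * n \<in> T")
      case True
      have "0 < d * n" using large_shiftD(2,4)[OF n] by linarith
      then have "nat (s - d * n) < nat s" using T_nonneg[OF True] by linarith
      then obtain i q where "i \<in> Ap n" "s - d * n = i + q * (d * n)" "0 \<le> q"
        using less True by blast
      then show ?thesis by (intro exI[of _ i] exI[of _ "q + 1"]) (auto simp: algebra_simps)
    next
      case False
      then show ?thesis using less.prems by (intro exI[of _ s] exI[of _ 0]) (auto simp: Ap_S_def)
    qed
  qed
  then show ?thesis using that by blast
qed

lemma Ap_incongruent:
  assumes n: "large_shift n" and i: "i \<in> Ap n" and j: "j \<in> Ap n" and c: "[i = j] (mod n)"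
  shows "i = j"
proof -
  have "n dvd i - j" "d dvd i - j"
    using c T_dvd[OF Ap_bounds(1)[OF i]] T_dvd[OF Ap_bounds(1)[OF j]] by (auto simp: cong_iff_dvd_diff)
  then have "d * n dvd i - j"
    using large_shiftD(1)[OF n] by (intro divides_mult) (auto simp: coprime_commute)
  then obtain q where q: "i = j + q * (d * n)" by (metis add.commute diff_add_cancel dvdE mult.commute)
  have "0 \<le> q" using Ap_minimal[OF n j] Ap_bounds(1)[OF i] q by simp
  moreover have "0 \<le> - q" using Ap_minimal[OF n i, of "- q"] Ap_bounds(1)[OF j] q by simp
  ultimately show ?thesis using q by simp
qed

text \<open>The inverse of \<open>P_index\<close>: if \<open>i + m i * n\<close> is a maximal element of the Apery set of \<open>M n\<close>, then
subtracting \<open>n\<close> gives a pseudo-Frobenius number.\<close>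

definition lift_PF :: "int \<Rightarrow> int \<Rightarrow> int" where
  "lift_PF n i = i + (m i - 1) * n"

text \<open>This expresses by \<open>m\<close> alone that \<open>i + m i * n\<close> is maximal in the Apery set of \<open>M n\<close>: adding the
generator \<open>n + r j\<close> leads to another element of the Apery set if and only if \<open>i + r j \<in> Ap n\<close> and
\<open>m (i + r j) = m i + 1\<close>.\<close>

definition maximal :: "int \<Rightarrow> int \<Rightarrow> bool" where
  "maximal n i \<longleftrightarrow> i \<in> Ap n \<and> (\<forall>j\<in>{1..k}. i + r j \<in> Ap n \<longrightarrow> m (i + r j) \<le> m i)"

lemma lift_PF_cong: "[lift_PF n i = i] (mod n)"
  by (simp add: lift_PF_def cong_iff_dvd_diff)

text \<open>A number \<open>f\<close> is pseudo-Frobenius if \<open>f \<notin> M n\<close> and \<open>f + (n + r j) \<in> M n\<close> for all \<open>j\<close>. The case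
\<open>j = 0\<close> puts \<open>f + n\<close> in the Apery set, so \<open>f = lift_PF n i\<close> with \<open>i \<in> Ap n\<close>. The condition for the other
\<open>j\<close> reads \<open>(i + r j) + m i * n \<in> M n\<close>, that is \<open>m (i + r j) \<le> m i\<close> if \<open>i + r j \<in> Ap n\<close>; it holds
automatically if \<open>i + r j\<close> leaves the Apery set.\<close>

lemma PF_iff:
  assumes n: "large_shift n"
  shows "f \<in> PF (M k r n) \<longleftrightarrow> (\<exists>i. maximal n i \<and> f = lift_PF n i)"
proof
  assume f: "f \<in> PF (M k r n)"
  note n0 = large_shiftD(2)[OF n]
  have f_gen: "f + (n + r j) \<in> M k r n" if "j \<le> k" for j
    using f M_generator[OF that] r_nonneg[OF that] n0 by (auto simp: PF_def)
  obtain a s where s: "s \<in> T" "f + n = int a * n + s"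
    using f_gen[of 0] r_zero by (auto simp: M_iff)
  obtain i q where i: "i \<in> Ap n" "s = i + q * (d * n)"
    using T_descend_to_Ap[OF n s(1)] by blast
  define b where "b = int a + q * d"
  have fb: "f = i + (b - 1) * n" using s(2) i(2) by (simp add: b_def algebra_simps)
  have "i + b * n \<in> M k r n" using f_gen[of 0] r_zero fb by (simp add: algebra_simps)
  then have "m i \<le> b" using Ap_M_iff[OF n i(1)] by simp
  moreover have "\<not> m i \<le> b - 1" using Ap_M_iff[OF n i(1), of "b - 1"] f fb by (simp add: PF_def)
  ultimately have b: "b = m i" by simp
  have "m (i + r j) \<le> m i" if j: "j \<in> {1..k}" and ij: "i + r j \<in> Ap n" for j
  proof -
    have eq: "f + (n + r j) = (i + r j) + m i * n" using fb b by (simp add: algebra_simps)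
    have "(i + r j) + m i * n \<in> M k r n" using f_gen[of j] j by (simp flip: eq)
    then show ?thesis using Ap_M_iff[OF n ij] by blast
  qed
  then show "\<exists>i. maximal n i \<and> f = lift_PF n i"
    using i(1) fb b by (intro exI[of _ i]) (auto simp: maximal_def lift_PF_def)
next
  assume "\<exists>i. maximal n i \<and> f = lift_PF n i"
  then obtain i where i: "i \<in> Ap n" and f: "f = i + (m i - 1) * n"
    and max: "\<And>j. j \<in> {1..k} \<Longrightarrow> i + r j \<in> Ap n \<Longrightarrow> m (i + r j) \<le> m i"
    by (auto simp: maximal_def lift_PF_def)
  note iT = Ap_bounds(1)[OF i]
  have gen: "f + (n + r j) \<in> M k r n" if j: "j \<le> k" for j
  proof -
    have eq: "f + (n + r j) = (i + r j) + m i * n" using f by (simp add: algebra_simps)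
    have ijT: "i + r j \<in> T" using T_add[OF iT r_in_T[OF j]] .
    show ?thesis
    proof (cases "i + r j \<in> Ap n")
      case True
      then have "m (i + r j) \<le> m i" using max[of j] j r_zero by (cases "j = 0") auto
      then show ?thesis unfolding eq using M_I[OF ijT] by blast
    next
      case False
      \<comment> \<open>Passing to \<open>i + r j - d * n\<close> frees \<open>d \<ge> 1\<close> further summands \<open>n\<close>.\<close>
      then have T': "i + r j - d * n \<in> T" using ijT by (simp add: Ap_S_def)
      have "m (i + r j - d * n) \<le> m (i + r j)"
        using min_len_mono_period[OF n T', of 1] ijT by simp
      also have "\<dots> \<le> m i + d" using min_len_add_r[OF iT j] d_pos by linarith
      finally show ?thesis unfolding eq using M_I[OF T', of "m i + d" n] by (simp add: algebra_simps)
    qed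
  qed
  have "f \<notin> M k r n" using Ap_M_iff[OF n i, of "m i - 1"] f by simp
  moreover have "f + h \<in> M k r n" if h: "h \<in> M k r n" "h \<noteq> 0" for h
  proof -
    obtain j where j: "j \<le> k" "h - (n + r j) \<in> M k r n" using M_split[OF h] by blast
    from M_add[OF gen[OF j(1)] j(2)] show ?thesis by (simp add: algebra_simps)
  qed
  ultimately show "f \<in> PF (M k r n)" by (simp add: PF_def)
qed

lemma P_iff:
  assumes n: "large_shift n"
  shows "i \<in> P k r n \<longleftrightarrow> maximal n i"
proof
  assume "i \<in> P k r n"
  then obtain f where i: "i \<in> Ap n" and f: "f \<in> PF (M k r n)" "[f = i] (mod n)"
    by (auto simp: P_def)
  obtain i' where i': "maximal n i'" "f = lift_PF n i'" using f(1) PF_iff[OF n] by blast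
  have "[i = i'] (mod n)" using f(2) i'(2) lift_PF_cong by (meson cong_sym cong_trans)
  then have "i = i'" using Ap_incongruent[OF n i] i'(1) by (simp add: maximal_def)
  then show "maximal n i" using i' by simp
next
  assume "maximal n i"
  moreover from this have "lift_PF n i \<in> PF (M k r n)" using PF_iff[OF n] by blast
  ultimately show "i \<in> P k r n" using lift_PF_cong by (auto simp: P_def maximal_def)
qed

lemma PF_eq:
  assumes n: "large_shift n"
  shows "PF (M k r n) = lift_PF n ` P k r n"
  using PF_iff[OF n] P_iff[OF n] by auto

lemma P_subset_Ap: "P k r n \<subseteq> Ap n"
  by (auto simp: P_def)

lemma P_index_lift_PF:
  assumes n: "large_shift n" and i: "i \<in> P k r n"
  shows "P_index k r n (lift_PF n i) = i"
  unfolding P_index_def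
proof (rule the_equality)
  show "i \<in> P k r n \<and> [lift_PF n i = i] (mod n)" using i lift_PF_cong by blast
next
  fix j assume j: "j \<in> P k r n \<and> [lift_PF n i = j] (mod n)"
  then have "[j = i] (mod n)" using lift_PF_cong by (meson cong_sym cong_trans)
  then show "j = i" using Ap_incongruent[OF n] i j P_subset_Ap by blast
qed

lemma lift_PF_unique:
  assumes n: "large_shift n" and i: "i \<in> P k r n"
  shows "(THE g. g \<in> PF (M k r n) \<and> [g = i] (mod n)) = lift_PF n i"
proof (rule the_equality)
  show "lift_PF n i \<in> PF (M k r n) \<and> [lift_PF n i = i] (mod n)"
    using PF_eq[OF n] i lift_PF_cong by blast
next
  fix g assume g: "g \<in> PF (M k r n) \<and> [g = i] (mod n)"
  then obtain j where j: "j \<in> P k r n" "g = lift_PF n j" using PF_eq[OF n] by blast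
  have "[j = i] (mod n)" using g j(2) lift_PF_cong by (meson cong_sym cong_trans)
  then have "j = i" using Ap_incongruent[OF n] i j P_subset_Ap by blast
  then show "g = lift_PF n i" using j by simp
qed

section \<open>The Apery set under the shift by the largest r\<close>

abbreviation Pn :: "int \<Rightarrow> int set" where "Pn n \<equiv> P k r n"
abbreviation low :: "int \<Rightarrow> int set" where "low n \<equiv> P_low k r n"
abbreviation high :: "int \<Rightarrow> int set" where "high n \<equiv> P_high k r n"

lemma Pn_split: "Pn n = low n \<union> high n"
  by (auto simp: P_low_def P_high_def)

lemma Pn_T: "i \<in> Pn n \<Longrightarrow> i \<in> T"
  using P_subset_Ap Ap_bounds(1) by blast

text \<open>For \<open>i < d * n - R\<close> all \<open>i + r j\<close> are below \<open>d * n\<close> and hence in \<open>Ap n\<close>. Maximality forbids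
\<open>m (i + R) = m i + 1\<close>, so \<open>i\<close> lies below the range where \<open>m\<close> is quasi-linear. What remains does not
mention \<open>n\<close>.\<close>

lemma low_iff:
  assumes n: "large_shift n"
  shows "i \<in> low n \<longleftrightarrow> i \<in> T \<and> i + R < R\<^sup>2 \<and> (\<forall>j\<in>{1..k}. m (i + r j) \<le> m i)"
proof
  assume "i \<in> low n"
  then have i: "i \<in> Ap n" "i < d * n - R" and max: "\<And>j. j \<in> {1..k} \<Longrightarrow> i + r j \<in> Ap n \<Longrightarrow> m (i + r j) \<le> m i"
    by (auto simp: P_low_def P_iff[OF n] maximal_def)
  note iT = Ap_bounds(1)[OF i(1)]
  have "i + r j \<in> Ap n" if "j \<in> {1..k}" for j
    using that i(2) r_le[of j] by (intro small_in_Ap T_add[OF iT] r_in_T) auto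
  then have all: "\<forall>j\<in>{1..k}. m (i + r j) \<le> m i" using max by blast
  have "i + R < R\<^sup>2"
  proof (rule ccontr)
    assume "\<not> i + R < R\<^sup>2"
    then have "m (i + R) = m i + 1" using min_len_large_shift[OF iT, of 1] by simp
    then show False using all k_pos by force
  qed
  then show "i \<in> T \<and> i + R < R\<^sup>2 \<and> (\<forall>j\<in>{1..k}. m (i + r j) \<le> m i)" using iT all by blast
next
  assume i: "i \<in> T \<and> i + R < R\<^sup>2 \<and> (\<forall>j\<in>{1..k}. m (i + r j) \<le> m i)"
  then have "i < d * n - R" using large_shiftD(5)[OF n] by linarith
  then show "i \<in> low n"
    using i R_pos small_in_Ap[of i n] by (auto simp: P_low_def P_iff[OF n] maximal_def)
qed

lemma low_step: "large_shift n \<Longrightarrow> low (n + R) = low n"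
  using low_iff low_iff[OF large_shift_step] by blast

lemma high_T:
  assumes n: "large_shift n" and t: "d dvd t" "d * n - R \<le> t"
  shows "t \<in> T" "R\<^sup>2 \<le> t + R" "m (t + d * R) = m t + d"
proof -
  show tT: "t \<in> T" using large_shiftD(8)[OF n] t by (intro F_properties(3)) auto
  show R2: "R\<^sup>2 \<le> t + R" using large_shiftD(5)[OF n] t(2) by linarith
  show "m (t + d * R) = m t + d" using min_len_large_shift[OF tT _ R2] d_pos by simp
qed

lemma Ap_step:
  assumes n: "large_shift n" and t: "d dvd t" "d * n - R \<le> t"
  shows "t + d * R \<in> Ap (n + R) \<longleftrightarrow> t \<in> Ap n"
proof -
  have "t + d * R \<in> T"
    using high_T(1)[OF n t] T_mult[OF r_in_T[of k], of d] d_pos by (intro T_add) auto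
  moreover have eq: "t + d * R - d * (n + R) = t - d * n" by (simp add: algebra_simps)
  ultimately show ?thesis using high_T(1)[OF n t] unfolding Ap_S_def mem_Collect_eq eq by blast
qed

text \<open>From \<open>d * n - R\<close> on, translation by \<open>d * R\<close> takes \<open>Ap n\<close> to \<open>Ap (n + R)\<close> and raises \<open>m\<close> by exactly
\<open>d\<close>, so it respects maximality.\<close>

lemma high_step:
  assumes n: "large_shift n"
  shows "high (n + R) = (\<lambda>i. i + d * R) ` high n"
proof -
  have shift: "i + d * R \<in> high (n + R) \<longleftrightarrow> i \<in> high n" if i: "d dvd i" for i
  proof (cases "d * n - R \<le> i")
    case True
    have "(i + d * R) + r j \<in> Ap (n + R) \<longleftrightarrow> i + r j \<in> Ap n"
      and "m ((i + d * R) + r j) = m (i + r j) + d" if "j \<in> {1..k}" for j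
    proof -
      have ij: "d dvd i + r j" "d * n - R \<le> i + r j"
        using i True that d_dvd_r[of j] r_nonneg[of j] by auto
      have eq: "(i + d * R) + r j = (i + r j) + d * R" by simp
      show "(i + d * R) + r j \<in> Ap (n + R) \<longleftrightarrow> i + r j \<in> Ap n"
        unfolding eq by (rule Ap_step[OF n ij])
      show "m ((i + d * R) + r j) = m (i + r j) + d"
        unfolding eq by (rule high_T(3)[OF n ij])
    qed
    then have "maximal (n + R) (i + d * R) \<longleftrightarrow> maximal n i"
      unfolding maximal_def Ap_step[OF n i True] high_T(3)[OF n i True] by auto
    moreover have "d * (n + R) - R \<le> i + d * R" using True by (simp add: algebra_simps)
    ultimately show ?thesis using True
      by (simp add: P_high_def P_iff[OF n] P_iff[OF large_shift_step[OF n]])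
  next
    case False
    then have "\<not> d * (n + R) - R \<le> i + d * R" by (simp add: algebra_simps)
    then show ?thesis using False by (simp add: P_high_def)
  qed
  have dvd: "d dvd i" if "i \<in> high l" for i l using that Pn_T T_dvd by (auto simp: P_high_def)
  show ?thesis
  proof (intro equalityI subsetI)
    fix i assume i: "i \<in> high (n + R)"
    then have "d dvd i - d * R" using dvd by simp
    then have "i - d * R \<in> high n" using shift[of "i - d * R"] i by simp
    then show "i \<in> (\<lambda>i. i + d * R) ` high n" by (intro image_eqI[of _ _ "i - d * R"]) auto
  qed (use shift dvd in auto)
qed

lemma psi_low: "i \<in> low n \<Longrightarrow> psi k r n i = i"
  by (simp add: psi_def P_low_def)

lemma psi_high: "i \<in> high n \<Longrightarrow> psi k r n i = i + d * R"
  by (simp add: psi_def P_high_def)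

lemma min_len_psi_high: "large_shift n \<Longrightarrow> i \<in> high n \<Longrightarrow> m (i + d * R) = m i + d"
  using high_T(3) Pn_T T_dvd by (auto simp: P_high_def)

lemma P_step:
  assumes n: "large_shift n"
  shows "Pn (n + R) = psi k r n ` Pn n"
proof -
  have "psi k r n ` low n = low n" using psi_low by (auto simp: image_iff)
  moreover have "psi k r n ` high n = (\<lambda>i. i + d * R) ` high n"
    using psi_high by (intro image_cong) auto
  ultimately show ?thesis by (simp add: Pn_split low_step[OF n] high_step[OF n] image_Un)
qed

lemma phi_lift_PF:
  assumes n: "large_shift n" and i: "i \<in> Pn n"
  shows "phi k r n (lift_PF n i) = lift_PF (n + R) (psi k r n i)"
  unfolding phi_def P_index_lift_PF[OF n i]
  using P_step[OF n] i by (intro lift_PF_unique[OF large_shift_step[OF n]]) auto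

section \<open>The inequalities behind the bound N\<close>

text \<open>The conditions \<open>N1 k r n < n\<close>, \<open>N2 k r n < n\<close> and \<open>N3 k r n < n\<close> without maxima and integer division.\<close>

definition bounded_gaps :: "int \<Rightarrow> bool" where
  "bounded_gaps n \<longleftrightarrow>
     (\<forall>i\<in>low n. \<forall>l\<in>low n. R + l - i < n \<and> (m l - m i) * R - l + i < n) \<and>
     (\<forall>i\<in>high n. \<forall>l\<in>high n. (m l - m i) * R - l + i < n) \<and>
     (\<forall>l\<in>low n. m l * R + 3 * R < d * n)"

lemma finite_Pn: "finite (Pn n)"
proof (rule finite_subset)
  show "Pn n \<subseteq> {0..d * n + F}"
    using P_subset_Ap[of n] Ap_bounds T_nonneg by fastforce
qed simp

text \<open>Since \<open>F \<ge> - d\<close>, the summand \<open>F div d\<close> of the bound is at least \<open>-1\<close>, so \<open>R + F div d\<close> is nonnegative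
and \<open>n\<close> exceeds \<open>N0\<close>. For \<open>F < 0\<close> the term \<open>R^2\<close> of \<open>N0\<close> gives the inequalities of \<open>large_shift\<close>, for
\<open>F \<ge> 0\<close> the term \<open>R^2 + F * R\<close>.\<close>

lemma above_N:
  assumes "gcd n d = 1" and N: "N k r n < n"
  shows "large_shift n" and "bounded_gaps n"
proof -
  have N': "N0 k r + R + F div d < n" "N1 k r n < n" "N2 k r n < n" "N3 k r n < n"
    using N by (auto simp: N_def)
  have Fd: "-1 \<le> F div d"
    using zdiv_mono1[OF F_ge d_pos] d_pos by (simp add: zdiv_zminus1_eq_if)
  have N0: "R\<^sup>2 \<le> N0 k r" "R\<^sup>2 + F * R \<le> N0 k r" by (auto simp: N0_def)
  show st: "large_shift n"
  proof (cases "0 \<le> F")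
    case True
    then have "F * 1 \<le> F * R" using R_pos by (intro mult_left_mono) auto
    moreover have "0 \<le> F div d" using True d_pos by (simp add: pos_imp_zdiv_nonneg_iff)
    ultimately show ?thesis using N'(1) N0 R_le_square True R_pos assms(1)
      unfolding large_shift_def by linarith
  next
    case False
    then show ?thesis using N'(1) N0 R_le_square R_pos Fd assms(1)
      unfolding large_shift_def by linarith
  qed
  have fin: "finite (low n)" "finite (high n)"
    using finite_Pn[of n] by (auto simp: P_low_def P_high_def)
  have fin2: "finite {g i l | i l. i \<in> A \<and> l \<in> A}" if "finite A" for g :: "int \<Rightarrow> int \<Rightarrow> int" and A
    using finite_image_set2[of "\<lambda>i. i \<in> A" "\<lambda>l. l \<in> A" g] that by simp
  have 1: "R + l - i < n" "(m l - m i) * R - l + i < n" if "i \<in> low n" "l \<in> low n" for i l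
  proof -
    have "x \<le> N1 k r n"
      if "x \<in> {R + l - i | i l. i \<in> low n \<and> l \<in> low n} \<union>
        {(m l - m i) * R - l + i | i l. i \<in> low n \<and> l \<in> low n}" for x
      unfolding N1_def using that fin by (intro Max_ge) (auto intro!: fin2)
    then have "R + l - i \<le> N1 k r n" "(m l - m i) * R - l + i \<le> N1 k r n"
      using that by blast+
    then show "R + l - i < n" "(m l - m i) * R - l + i < n" using N' by auto
  qed
  have 2: "(m l - m i) * R - l + i < n" if "i \<in> high n" "l \<in> high n" for i l
  proof -
    have "(m l - m i) * R - l + i \<le> N2 k r n"
      unfolding N2_def using that fin by (intro Max_ge) (auto intro!: fin2)
    then show ?thesis using N' by simp
  qed
  have 3: "m l * R + 3 * R < d * n" if "l \<in> low n" for l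
  proof -
    have "(m l * R + 3 * R) div d \<le> N3 k r n"
      unfolding N3_def using that fin by (intro Max_ge) auto
    then have "(m l * R + 3 * R) div d < n" using N' by simp
    moreover have "d dvd m l * R + 3 * R" using d_dvd_r[of k] by simp
    ultimately show ?thesis using d_pos
      by (metis dvd_mult_div_cancel mult_strict_left_mono)
  qed
  show "bounded_gaps n" unfolding bounded_gaps_def using 1 2 3 by blast
qed

text \<open>Low indices are unchanged under the shift, and for high indices the quantity
\<open>(m l - m i) * R - l + i\<close> is invariant under translation by \<open>d * R\<close>; so the left-hand sides remain the
same, while \<open>n\<close> grows.\<close>

lemma bounded_gaps_step:
  assumes n: "large_shift n" and b: "bounded_gaps n"
  shows "bounded_gaps (n + R)"
proof -
  have dn: "d * n < d * (n + R)" "n < n + R" using d_pos R_pos by simp_all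
  have "(m (l + d * R) - m (i + d * R)) * R - (l + d * R) + (i + d * R) < n + R"
    if "i \<in> high n" "l \<in> high n" for i l
    using b that dn(2) unfolding bounded_gaps_def min_len_psi_high[OF n that(1)] min_len_psi_high[OF n that(2)]
    by fastforce
  then have "\<forall>i\<in>high (n + R). \<forall>l\<in>high (n + R). (m l - m i) * R - l + i < n + R"
    unfolding high_step[OF n] by blast
  moreover have "R + l - i < n + R \<and> (m l - m i) * R - l + i < n + R" if "i \<in> low n" "l \<in> low n" for i l
    using b that dn(2) unfolding bounded_gaps_def by fastforce
  moreover have "m l * R + 3 * R < d * (n + R)" if "l \<in> low n" for l
    using b that dn(1) unfolding bounded_gaps_def by fastforce
  ultimately show ?thesis unfolding bounded_gaps_def low_step[OF n] by blast
qed

section \<open>Transport of NG-vectors\<close>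

text \<open>The condition on an NG-vector with \<open>j\<close>-th entry \<open>lift_PF n i\<close>, tested against the pseudo-Frobenius
number \<open>lift_PF n l\<close>.\<close>

definition compatible :: "int \<Rightarrow> nat \<Rightarrow> int \<Rightarrow> int \<Rightarrow> bool" where
  "compatible n j i l \<longleftrightarrow> n + r j + lift_PF n i - lift_PF n l \<in> M k r n"

lemma compatible_iff:
  "compatible n j i l \<longleftrightarrow> (r j + i - l) + (m i - m l + 1) * n \<in> M k r n"
proof -
  have "n + r j + lift_PF n i - lift_PF n l = (r j + i - l) + (m i - m l + 1) * n"
    by (simp add: lift_PF_def algebra_simps)
  then show ?thesis unfolding compatible_def by (simp only:)
qed

text \<open>The hypotheses leave only \<open>q = 0\<close> in \<open>M_membership\<close>: \<open>x + q * d * n\<close> would be negative for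
\<open>q < 0\<close>, and have too large a length for \<open>q > 0\<close>. The conclusion does not mention \<open>n\<close>.\<close>

lemma compatible_same_kind:
  assumes n: "large_shift n" and j: "j \<le> k" and i: "i \<in> T" and l: "l \<in> T"
    and c: "compatible n j i l"
    and x: "r j + i - l < d * n" and gap: "(m i - m l) * R - i + l < n"
  shows "r j + i - l \<in> T \<and> m (r j + i - l) \<le> m i - m l + 1"
proof -
  define x where "x = r j + i - l"
  have "d dvd x" using d_dvd_r[OF j] T_dvd[OF i] T_dvd[OF l] by (simp add: x_def)
  then obtain q where q: "x + q * (d * n) \<in> T" "m (x + q * (d * n)) + q * d \<le> m i - m l + 1"
    using c M_membership[OF n] by (auto simp: compatible_iff x_def)
  note dn = large_shiftD(2,4)[OF n]
  have "0 \<le> q"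
  proof (rule ccontr)
    assume "\<not> 0 \<le> q"
    then have "q * (d * n) \<le> (-1) * (d * n)" using dn by (intro mult_right_mono) auto
    then show False using T_nonneg[OF q(1)] x by (simp add: x_def)
  qed
  moreover have "q \<le> 0"
  proof (rule ccontr)
    \<comment> \<open>Each generator of \<open>T\<close> is at most \<open>R\<close>, so the length of \<open>x + q * d * n\<close> is too large.\<close>
    assume "\<not> q \<le> 0"
    then have q1: "1 * (d * n) \<le> q * (d * n)" "1 * 1 \<le> q * d"
      using dn d_pos by (intro mult_right_mono mult_mono; simp)+
    have "x + q * (d * n) \<le> m (x + q * (d * n)) * R" by (rule le_min_len[OF q(1)])
    also have "\<dots> \<le> (m i - m l) * R" using q(2) q1 R_pos by (intro mult_right_mono) auto
    finally show False using q1 gap dn r_nonneg[OF j] by (simp add: x_def)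
  qed
  ultimately show ?thesis using q by (simp add: x_def)
qed

text \<open>The length of a high index is at least \<open>(d * n - R) / R\<close>, which by the bound \<open>N3\<close> exceeds the length
of every low index by more than 2. So the element in question would be negative.\<close>

lemma not_compatible_low_high:
  assumes n: "large_shift n" and b: "bounded_gaps n" and j: "j \<le> k" and i: "i \<in> low n" and l: "l \<in> high n"
  shows "\<not> compatible n j i l"
proof
  assume "compatible n j i l"
  then have c: "(r j + i - l) + (m i - m l + 1) * n \<in> M k r n" by (simp add: compatible_iff)
  have "m i * R + 3 * R < d * n" using b i by (auto simp: bounded_gaps_def)
  also have "d * n \<le> l + R" using l by (auto simp: P_high_def)
  also have "l \<le> m l * R" using l Pn_T le_min_len by (auto simp: P_high_def)
  finally have "(m i + 2) * R < m l * R" by (simp add: algebra_simps)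
  then have "m i - m l + 1 \<le> -1" using R_pos by simp
  then have "(m i - m l + 1) * n \<le> (-1) * n" using large_shiftD(2)[OF n] by (intro mult_right_mono) auto
  moreover have "r j + i - l < n"
    using i l r_le[OF j] large_shiftD(3)[OF n] by (auto simp: P_low_def P_high_def)
  ultimately have "(r j + i - l) + (m i - m l + 1) * n < 0" by simp
  then show False using c numerical_semigroup_M[OF n] by (auto simp: numerical_semigroup_def)
qed

text \<open>Here \<open>x = r j + i - l\<close> and \<open>a = m i - m l + 1\<close> grow by \<open>d * R\<close> and \<open>d\<close>. For the witness \<open>q \<ge> 0\<close> at
\<open>n\<close> one may take \<open>q = 0\<close>, as \<open>x\<close> exceeds \<open>F\<close> and is thus itself in \<open>T\<close>; it works at \<open>n + R\<close> because
\<open>d * R\<close> costs at most \<open>d\<close> generators. The witness \<open>q = -1\<close> works at \<open>n + R\<close> because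
\<open>x + d * R - d * (n + R) = x - d * n\<close>. Smaller \<open>q\<close> would require \<open>x \<ge> 2 * d * n\<close>.\<close>

lemma compatible_high_low_step:
  assumes n: "large_shift n" and j: "j \<le> k" and i: "i \<in> high n" and l: "l \<in> low n"
    and c: "compatible n j i l"
  shows "compatible (n + R) j (i + d * R) l"
proof -
  have iP: "i \<in> Ap n" "d * n - R \<le> i" using i P_subset_Ap by (auto simp: P_high_def)
  note iT = Ap_bounds(1)[OF iP(1)]
  have lT: "l \<in> T" and lR: "l + R < R\<^sup>2" using l low_iff[OF n] by auto
  define x where "x = r j + i - l"
  have dx: "d dvd x" using d_dvd_r[OF j] T_dvd[OF iT] T_dvd[OF lT] by (simp add: x_def)
  have xT: "x \<in> T"
    using dx iP(2) lR r_nonneg[OF j] large_shiftD(6)[OF n] by (intro F_properties(3)) (auto simp: x_def)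
  obtain q where q: "x + q * (d * n) \<in> T" "m (x + q * (d * n)) + q * d \<le> m i - m l + 1"
    using c M_membership[OF n dx] by (auto simp: compatible_iff x_def)
  note dn = large_shiftD(2,4)[OF n]
  have "\<exists>q. (x + d * R) + q * (d * (n + R)) \<in> T \<and>
      m ((x + d * R) + q * (d * (n + R))) + q * d \<le> m i - m l + 1 + d"
  proof (cases "0 \<le> q")
    case True
    then have "m x \<le> m (x + q * (d * n))" using min_len_mono_period[OF n xT q(1)] by simp
    moreover have "0 \<le> q * d" using True d_pos by simp
    ultimately have "m (x + d * R) \<le> m i - m l + 1 + d"
      using q(2) min_len_add_multiple_R[OF xT, of d] d_pos by linarith
    moreover have "x + d * R \<in> T" using xT T_mult[OF r_in_T[of k], of d] d_pos by (intro T_add) auto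
    ultimately show ?thesis by (intro exI[of _ 0]) auto
  next
    case False
    have "q = -1"
    proof (rule ccontr)
      assume "q \<noteq> -1"
      then have "q * (d * n) \<le> (-2) * (d * n)" using False dn by (intro mult_right_mono) auto
      then have "2 * (d * n) \<le> x" using T_nonneg[OF q(1)] by simp
      moreover have "x \<le> R + (d * n + F)"
        using r_le[OF j] Ap_bounds(2)[OF iP(1)] T_nonneg[OF lT] by (simp add: x_def)
      ultimately show False using large_shiftD(8)[OF n] by simp
    qed
    moreover have eq: "(x + d * R) + (-1) * (d * (n + R)) = x + (-1) * (d * n)"
      by (simp add: algebra_simps)
    ultimately show ?thesis using q d_pos by (intro exI[of _ "-1"], unfold eq) simp
  qed
  then have "(x + d * R) + (m i - m l + 1 + d) * (n + R) \<in> M k r (n + R)"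
    using M_membership[OF large_shift_step[OF n], of "x + d * R" "m i - m l + 1 + d"] dx by auto
  then show ?thesis
    unfolding compatible_iff min_len_psi_high[OF n i] by (simp add: x_def algebra_simps)
qed

lemma compatible_step:
  assumes n: "large_shift n" and b: "bounded_gaps n" and j: "j \<le> k"
    and i: "i \<in> Pn n" and l: "l \<in> Pn n" and c: "compatible n j i l"
  shows "compatible (n + R) j (psi k r n i) (psi k r n l)"
proof -
  note iT = Pn_T[OF i] and lT = Pn_T[OF l]
  consider "i \<in> low n" "l \<in> low n" | "i \<in> high n" "l \<in> high n" | "i \<in> low n" "l \<in> high n"
    | "i \<in> high n" "l \<in> low n"
    using i l Pn_split by blast
  then show ?thesis
  proof cases
    case 1
    have "R + i - l < n" "(m i - m l) * R - i + l < n" using b 1 by (auto simp: bounded_gaps_def)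
    then have "r j + i - l \<in> T \<and> m (r j + i - l) \<le> m i - m l + 1"
      using r_le[OF j] large_shiftD(4)[OF n] by (intro compatible_same_kind[OF n j iT lT c]) auto
    then show ?thesis using M_I by (simp add: compatible_iff psi_low[OF 1(1)] psi_low[OF 1(2)])
  next
    case 2
    have "i \<le> d * n + F" using i P_subset_Ap Ap_bounds(2) by blast
    then have "r j + i - l < d * n"
      using r_le[OF j] 2(2) large_shiftD(7)[OF n] by (auto simp: P_high_def)
    moreover have "(m i - m l) * R - i + l < n" using b 2 by (auto simp: bounded_gaps_def)
    ultimately have res: "r j + i - l \<in> T \<and> m (r j + i - l) \<le> m i - m l + 1"
      by (rule compatible_same_kind[OF n j iT lT c])
    have eqs: "r j + (i + d * R) - (l + d * R) = r j + i - l"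
      "m i + d - (m l + d) + 1 = m i - m l + 1" by simp_all
    show ?thesis
      unfolding compatible_iff psi_high[OF 2(1)] psi_high[OF 2(2)]
        min_len_psi_high[OF n 2(1)] min_len_psi_high[OF n 2(2)] eqs
      using res M_I by blast
  next
    case 3
    then show ?thesis using not_compatible_low_high[OF n b j] c by blast
  next
    case 4
    then show ?thesis using compatible_high_low_step[OF n j 4 c] by (simp add: psi_low psi_high)
  qed
qed

lemma NG_vector_step:
  assumes n: "large_shift n" and b: "bounded_gaps n"
    and f: "NG_vector (M k r n) k (shifted_gens r n) f"
  shows "NG_vector (M k r (n + R)) k (shifted_gens r (n + R)) (\<lambda>i. phi k r n (f i))"
proof -
  note n' = large_shift_step[OF n]
  have fP: "\<exists>i\<in>Pn n. f j = lift_PF n i" if "j \<le> k" for j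
    using f that PF_eq[OF n] by (auto simp: NG_vector_def)
  have phi_PF: "phi k r n (f j) \<in> PF (M k r (n + R))" if "j \<le> k" for j
    using fP[OF that] phi_lift_PF[OF n] P_step[OF n] PF_eq[OF n'] by auto
  have "shifted_gens r (n + R) j + phi k r n (f j) - g \<in> M k r (n + R)"
    if j: "j \<le> k" and g: "g \<in> PF (M k r (n + R))" for j g
  proof -
    obtain i where i: "i \<in> Pn n" "f j = lift_PF n i" using fP[OF j] by blast
    obtain l where l: "l \<in> Pn n" "g = lift_PF (n + R) (psi k r n l)"
      using g PF_eq[OF n'] P_step[OF n] by auto
    have "lift_PF n l \<in> PF (M k r n)" using l(1) PF_eq[OF n] by blast
    then have "compatible n j i l"
      using f j i(2) by (auto simp: NG_vector_def compatible_def shifted_gens_def)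
    from compatible_step[OF n b j i(1) l(1) this]
    show ?thesis
      by (simp add: compatible_def shifted_gens_def i(2) l(2) phi_lift_PF[OF n i(1)])
  qed
  then show ?thesis
    using numerical_semigroup_M[OF n'] M_minimally_generated[OF n'] phi_PF
    by (auto simp: NG_vector_def)
qed

lemma large_shift_bounded_gaps_iterate:
  assumes "large_shift n" "bounded_gaps n"
  shows "large_shift (n + int l * R) \<and> bounded_gaps (n + int l * R)"
proof (induction l)
  case 0
  show ?case using assms by simp
next
  case (Suc l)
  have eq: "n + int (Suc l) * R = n + int l * R + R" by (simp add: algebra_simps)
  show ?case unfolding eq
    using Suc large_shift_step[of "n + int l * R"] bounded_gaps_step[of "n + int l * R"] by blast
qed

lemma NG_vector_iterate:
  assumes "large_shift n" "bounded_gaps n" "NG_vector (M k r n) k (shifted_gens r n) f"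
  shows "NG_vector (M k r (n + int l * R)) k (shifted_gens r (n + int l * R))
    (\<lambda>i. phi_iter k r n l (f i))"
proof (induction l)
  case 0
  show ?case using assms by simp
next
  case (Suc l)
  have eq: "n + int (Suc l) * R = n + int l * R + R" by (simp add: algebra_simps)
  show ?case unfolding eq phi_iter.simps
    using NG_vector_step[OF _ _ Suc] large_shift_bounded_gaps_iterate[OF assms(1,2), of l] by blast
qed

end

theorem theorem3p4:
  fixes k :: nat and r :: "nat \<Rightarrow> int" and n :: int
  assumes "k \<ge> 2"
    and "r 0 = 0"
    and "strict_mono_on {..k} r"
    and "n > 0"
    and "gcd n (gcd_r k r) = 1"
    and "n > N k r n"
  shows "(nearly_gorenstein (M k r n) \<longrightarrow>
            (\<forall>l::nat. nearly_gorenstein (M k r (n + int l * r k))))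
       \<and> (\<forall>f. NG_vector (M k r n) k (shifted_gens r n) f \<longrightarrow>
            (\<forall>l::nat. NG_vector (M k r (n + int l * r k)) k
               (shifted_gens r (n + int l * r k)) (\<lambda>i. phi_iter k r n l (f i))))"
proof -
  interpret shift_data k r using assms by unfold_locales auto
  note n = above_N[OF assms(5,6)]
  note NG = NG_vector_iterate[OF n]
  have "nearly_gorenstein (M k r (n + int l * r k))" if "nearly_gorenstein (M k r n)" for l
    using that NG large_shift_bounded_gaps_iterate[OF n] nearly_gorenstein_M_iff n(1) by blast
  then show ?thesis using NG by blast
qed

end
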